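(* There is an absolute constant $c>0$ such that the following holds. Let $T$ be a hierarchically well separated tree (HST) with parameter $2$, and let $R$ be any finite set of queueing requests issued, in an arbitrarily dynamic (possibly concurrent) manner, at the leaves of $T$, together with the dummy request $r_0=(v_0,0)$ at a leaf $v_0$. Then for every execution of the Arrow protocol on $T$ with request set $R$ — synchronous or asynchronous — the total cost of Arrow is at most $c\cdot \mathrm{OPT}_T(R)$.
   Context: HST with parameter $2$ and depth $h$: a rooted edge-weighted tree in which all leaves are at the same depth $h$; levels are numbered so that leaves are on level $0$ and the root is on level $h$, and every edge joining a level-$\ell$ node to one of its children (on level $\ell-1$) has length $2^{\ell-1}$. Thus two leaves whose lowest common ancestor is on level $\ell$ are at tree distance $\delta(\ell)=2^{\ell+1}-2$. $d_T$ denotes the weighted tree distance. Requests: a request is a pair $r=(v,t)$ meaning it is issued at node $v$ at time $t\ge 0$. There is a dummy request $r_0=(v_0,0)$ that defines the initial tail of the queue and must be ordered first. Arrow protocol on a weighted tree $T$: each node $u$ stores a pointer $\mathrm{link}(u)\in\{u\}\cup\{\text{neighbours of }u\}$. Initially $\mathrm{link}(v_0)=v_0$ and every other node points to its neighbour on the tree path towards $v_0$. When a request $r$ is issued at node $v$: if $\mathrm{link}(v)=v$, then $r$ is queued directly behind the previous request issued at $v$; otherwise, atomically, a message $\mathrm{find}(r)$ is sent to $u=\mathrm{link}(v)$ and $\mathrm{link}(v)$ is set to $v$. When a node $u$ receives $\mathrm{find}(r)$ from a neighbour $w$: if $\mathrm{link}(u)=u$, atomically $r$ is queued directly behind the last request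 issued at $u$ (which becomes $r$'s predecessor) and $\mathrm{link}(u)$ is set to $w$; otherwise, atomically, $\mathrm{find}(r)$ is forwarded to $\mathrm{link}(u)$ and $\mathrm{link}(u)$ is set to $w$. This produces a total order $r_0,r_1,\dots,r_{|R|-1}$ of the requests. Executions: in a synchronous execution a message over edge $e$ takes exactly time $w(e)$; in an asynchronous execution message delays are arbitrary but the delay over edge $e$ is at most $w(e)$. Cost of Arrow: the latency of $r_i=(v_i,t_i)$, $i\ge1$, is $t^*_i-t_i$, where $t^*_i$ is the time at which the node of its predecessor $r_{i-1}$ learns about $r_i$ (receives $\mathrm{find}(r_i)$); the total cost is the sum of the latencies of $r_1,\dots,r_{|R|-1}$. Optimal offline cost on a weighted graph $H$: $\mathrm{OPT}_H(R)=\min_\pi\sum_{i=1}^{|R|-1}\max\{d_H(v_{\pi(i-1)},v_{\pi(i)}),\,t_{\pi(i-1)}-t_{\pi(i)}\}$, the minimum over all orderings $\pi$ of the requests with $\pi(0)=0$ (dummy request first). *)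

theory Defs
  imports Complex_Main "HOL-Combinatorics.Permutations"
begin

(* Nodes of a rooted tree are encoded as paths from the root: lists of child labels.
   The root is [], the children of x are the x @ [i] in the node set. *)

definition is_hst :: "nat list set \<Rightarrow> nat \<Rightarrow> bool" where
  "is_hst N h \<longleftrightarrow> finite N \<and> [] \<in> N
     \<and> (\<forall>x\<in>N. \<forall>k. take k x \<in> N)
     \<and> (\<forall>x\<in>N. length x \<le> h)
     \<and> (\<forall>x\<in>N. length x < h \<longrightarrow> (\<exists>i. x @ [i] \<in> N))"

(* a node x at depth |x| lies on level h - |x|; the edge from x to a child has
   length 2^(level(x) - 1) = 2^(h - |x| - 1).  Edge weight between neighbours x,y: *)
definition edge_w :: "nat \<Rightarrow> nat list \<Rightarrow> nat list \<Rightarrow> real" where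
  "edge_w h x y = (2::real) ^ (h - Suc (min (length x) (length y)))"

fun lcp_len :: "nat list \<Rightarrow> nat list \<Rightarrow> nat" where
  "lcp_len (a # xs) (b # ys) = (if a = b then Suc (lcp_len xs ys) else 0)"
| "lcp_len _ _ = 0"

(* weighted tree distance: path through the lowest common ancestor *)
definition dT :: "nat \<Rightarrow> nat list \<Rightarrow> nat list \<Rightarrow> real" where
  "dT h x y = (\<Sum>k\<in>{lcp_len x y..<length x}. (2::real) ^ (h - Suc k))
            + (\<Sum>k\<in>{lcp_len x y..<length y}. (2::real) ^ (h - Suc k))"

(* requests are indexed 0..<n; req i = (node, time); request 0 is the dummy r0 *)
definition opt_cost :: "nat \<Rightarrow> nat \<Rightarrow> (nat \<Rightarrow> nat list \<times> real) \<Rightarrow> real" where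
  "opt_cost h n req = Min {(\<Sum>i\<in>{1..<n}. max (dT h (fst (req (\<pi> (i - 1)))) (fst (req (\<pi> i))))
                                           (snd (req (\<pi> (i - 1))) - snd (req (\<pi> i))))
                          | \<pi>. \<pi> permutes {0..<n} \<and> \<pi> 0 = 0}"

record cfg =
  clock  :: real
  issued :: "nat set"
  lnk    :: "nat list \<Rightarrow> nat list"
  lst    :: "nat list \<Rightarrow> nat"
  msgs   :: "(nat \<times> nat list \<times> nat list \<times> real) set"
                 (* messages in transit: find(r), sender, receiver, sending time *)
  res    :: "nat \<Rightarrow> (nat \<times> real) option"
                 (* queued requests: (predecessor, time t* its node learns about it) *)

definition init_link :: "nat list \<Rightarrow> nat list \<Rightarrow> nat list" where
  "init_link v0 u = (if u = v0 then u
                     else if take (length u) v0 = u \<and> length u < length v0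
                          then take (Suc (length u)) v0
                          else butlast u)"

definition init_cfg :: "(nat \<Rightarrow> nat list \<times> real) \<Rightarrow> cfg" where
  "init_cfg req = \<lparr> clock = 0, issued = {}, lnk = init_link (fst (req 0)),
                    lst = (\<lambda>_. 0), msgs = {}, res = (\<lambda>_. None) \<rparr>"

definition issue_step :: "cfg \<Rightarrow> nat \<Rightarrow> nat list \<Rightarrow> real \<Rightarrow> cfg" where
  "issue_step C i v t =
     (if lnk C v = v then
        C\<lparr> clock := t, issued := insert i (issued C), lst := (lst C)(v := i),
           res := (res C)(i := Some (lst C v, t)) \<rparr>
      else
        C\<lparr> clock := t, issued := insert i (issued C),
           msgs := insert (i, v, lnk C v, t) (msgs C),
           lnk := (lnk C)(v := v), lst := (lst C)(v := i) \<rparr>)"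

definition recv_step :: "cfg \<Rightarrow> nat \<times> nat list \<times> nat list \<times> real \<Rightarrow> real \<Rightarrow> cfg" where
  "recv_step C m t = (case m of (i, w, u, s) \<Rightarrow>
     (if lnk C u = u then
        C\<lparr> clock := t, msgs := msgs C - {m}, lnk := (lnk C)(u := w),
           res := (res C)(i := Some (lst C u, t)) \<rparr>
      else
        C\<lparr> clock := t, msgs := insert (i, u, lnk C u, t) (msgs C - {m}),
           lnk := (lnk C)(u := w) \<rparr>))"

(* configurations reachable by an execution; events are processed in time order
   (ties in arbitrary order).  sync: every message over edge e takes exactly w(e);
   otherwise (asynchronous) the delay is arbitrary in [0, w(e)]. *)
inductive arrow_reach :: "nat \<Rightarrow> bool \<Rightarrow> nat \<Rightarrow> (nat \<Rightarrow> nat list \<times> real) \<Rightarrow> cfg \<Rightarrow> bool"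
  for h :: nat and sync :: bool and n :: nat and req :: "nat \<Rightarrow> nat list \<times> real" where
  init: "arrow_reach h sync n req (init_cfg req)"
| issue: "\<lbrakk> arrow_reach h sync n req C; i \<in> {1..<n}; i \<notin> issued C; clock C \<le> snd (req i) \<rbrakk>
          \<Longrightarrow> arrow_reach h sync n req (issue_step C i (fst (req i)) (snd (req i)))"
| recv: "\<lbrakk> arrow_reach h sync n req C; (i, w, u, s) \<in> msgs C; clock C \<le> t; s \<le> t;
           t \<le> s + edge_w h w u; sync \<longrightarrow> t = s + edge_w h w u \<rbrakk>
          \<Longrightarrow> arrow_reach h sync n req (recv_step C (i, w, u, s) t)"

definition arrow_complete :: "nat \<Rightarrow> cfg \<Rightarrow> bool" where
  "arrow_complete n C \<longleftrightarrow> issued C = {1..<n} \<and> msgs C = {} \<and> (\<forall>i\<in>{1..<n}. res C i \<noteq> None)"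

definition arrow_cost :: "nat \<Rightarrow> (nat \<Rightarrow> nat list \<times> real) \<Rightarrow> cfg \<Rightarrow> real" where
  "arrow_cost n req C = (\<Sum>i\<in>{1..<n}. snd (the (res C i)) - snd (req i))"

end

theory Submission
  imports Defs "HOL-Analysis.Analysis" "HOL-Library.Sublist"
begin

text \<open>
  The cost of Arrow is the integral over time of the number of messages in transit. Let \<open>\<theta>(z)\<close> be four
  times the length of the edge above a node \<open>z\<close>. View an optimal tour as a path in space-time. The time
  it moves backwards, and the tree distance it covers, are both at most OPT. Call \<open>z\<close> crossed at time
  \<open>x\<close> if some tour step passes over \<open>x\<close> with both endpoints below \<open>z\<close>, and active if a request below \<open>z\<close>
  was issued during the last \<open>\<theta>(z)\<close> time units. If \<open>z\<close> is active but not crossed, then either the tour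
  leaves or enters the subtree of \<open>z\<close> near \<open>x\<close>, which is paid for by the distance of that step, or the
  tour has a dead end there, that is, it turns back in time. Hence the total time during which nodes
  are active but not crossed is O(OPT).

  At a fixed time, consider an edge carrying a message, with lower end \<open>z\<close>. If \<open>z\<close> is not crossed, charge \<open>z\<close>.
  Otherwise follow the links upwards to the turning point \<open>w\<close>, where they lead into another child \<open>s\<close>
  of \<open>w\<close>. If \<open>s\<close> is crossed as well, two different tour steps cross below \<open>w\<close>, and the number of such
  edges is at most twice the number of crossing steps minus one, which is bounded by the number of
  backward steps. Otherwise charge \<open>s\<close>. A charged node is active, or it is idle. In the latter case
  the charge ends within time \<open>\<theta>/2\<close> because a message soon arrives at the node or its parent and
  turns the link away until a new request is issued below, and this short time is paid for by the
  period \<open>\<theta>\<close> after the last request, in which the node was active and not crossed.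
\<close>

section \<open>The optimal tour in space-time\<close>

definition theta :: "nat \<Rightarrow> nat list \<Rightarrow> real" where
  "theta h z = 4 * 2 ^ (h - length z)"

lemma theta_pos: "theta h z > 0"
  by (simp add: theta_def)

locale tour =
  fixes h n :: nat and v :: "nat \<Rightarrow> nat list" and t :: "nat \<Rightarrow> real"
  assumes n_pos: "1 \<le> n"
    and leaf: "i < n \<Longrightarrow> length (v i) = h"
    and t0: "t 0 = 0"
    and t_nonneg: "i < n \<Longrightarrow> 0 \<le> t i"
begin

text \<open>Restricting to ancestors of requested leaves gives a finite index set for all sums over
  charged nodes.\<close>

definition nodes :: "nat list set" where
  "nodes = {z. \<exists>i<n. prefix z (v i)}"

text \<open>A request issued exactly at \<open>x\<close> counts as not after \<open>x\<close>, here
  and in \<open>up\<close>. With this convention the crossings in the two directions alternate along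
  the tour.\<close>

definition down :: "real \<Rightarrow> nat set" where
  "down x = {i\<in>{1..<n}. t i \<le> x \<and> x < t (i - 1)}"

definition up :: "real \<Rightarrow> nat set" where
  "up x = {i\<in>{1..<n}. t (i - 1) \<le> x \<and> x < t i}"

definition latest :: nat where
  "latest = (SOME j. j < n \<and> (\<forall>i<n. t i \<le> t j))"

text \<open>Step 0 stands for a virtual last step that waits forever at the location of the latest request.\<close>

definition crossing :: "real \<Rightarrow> nat set" where
  "crossing x = up x \<union> down x \<union> (if \<forall>i<n. t i \<le> x then {0} else {})"

definition stays :: "nat \<Rightarrow> nat list \<Rightarrow> bool" where
  "stays i z = (if i = 0 then prefix z (v latest) else prefix z (v (i - 1)) \<and> prefix z (v i))"

definition through :: "nat list \<Rightarrow> real \<Rightarrow> bool" where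
  "through z x \<longleftrightarrow> (\<exists>i\<in>crossing x. stays i z)"

text \<open>A canonical crossing step for a crossed node. Descending in the tree only removes
  candidate steps, so the index can only grow; where it changes, it differs from the overall
  minimum.\<close>

definition first_cross :: "real \<Rightarrow> nat list \<Rightarrow> nat" where
  "first_cross x z = Min {i\<in>crossing x. stays i z}"

definition active :: "nat list \<Rightarrow> real \<Rightarrow> bool" where
  "active z x \<longleftrightarrow> (\<exists>j<n. prefix z (v j) \<and> x - theta h z < t j \<and> t j \<le> x)"

definition charged :: "nat list \<Rightarrow> real \<Rightarrow> bool" where
  "charged z x \<longleftrightarrow> active z x \<and> \<not> through z x"

text \<open>Each window starts at the endpoint inside the subtree and lasts as long as
  \<open>charged_cases\<close> looks back.\<close>

definition paid :: "nat list \<Rightarrow> real \<Rightarrow> bool" where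
  "paid z x \<longleftrightarrow> (\<exists>i\<in>{1..<n}.
     prefix z (v i) \<and> \<not> prefix z (v (i - 1)) \<and> t i \<le> x \<and> x < t i + 2 * theta h z \<or>
     prefix z (v (i - 1)) \<and> \<not> prefix z (v i) \<and> t (i - 1) \<le> x \<and> x < t (i - 1) + 2 * theta h z)"

text \<open>A maximal block of consecutive tour positions after time \<open>x\<close>; it may touch
  either end of the tour.\<close>

definition run :: "real \<Rightarrow> nat \<Rightarrow> nat \<Rightarrow> bool" where
  "run x a b \<longleftrightarrow> a \<le> b \<and> b < n \<and> (\<forall>j\<in>{a..b}. x < t j) \<and>
     (a = 0 \<or> t (a - 1) \<le> x) \<and> (Suc b < n \<longrightarrow> t (Suc b) \<le> x)"

text \<open>The latest time of the block lies between \<open>x + theta h z\<close> and twice that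
  delay, a dyadic window that reveals the level of \<open>z\<close>. The last conjunct forces the
  tour to step back across \<open>x\<close> even when the block ends the tour.\<close>

definition dead :: "nat list \<Rightarrow> real \<Rightarrow> bool" where
  "dead z x \<longleftrightarrow> (\<exists>b<n. \<exists>a\<le>b. run x a b \<and> (\<forall>j\<in>{a..b}. prefix z (v j) \<and> t j \<le> x + 2 * theta h z) \<and>
     (\<exists>j\<in>{a..b}. x + theta h z < t j) \<and> (\<exists>j<n. j \<notin> {a..b} \<and> x < t j))"

lemma finite_nodes: "finite nodes"
proof -
  have "nodes \<subseteq> (\<Union>i\<in>{..<n}. set (prefixes (v i)))"
    by (auto simp: nodes_def)
  then show ?thesis by (rule finite_subset) simp
qed

lemma latest: "latest < n" "i < n \<Longrightarrow> t i \<le> t latest"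
proof -
  have fin: "finite (t ` {..<n})" "t ` {..<n} \<noteq> {}" using n_pos by (auto simp: lessThan_empty_iff)
  have "Max (t ` {..<n}) \<in> t ` {..<n}" using fin by (rule Max_in)
  then obtain j where "j < n" "t j = Max (t ` {..<n})" by (auto simp: image_iff)
  then have "\<exists>j. j < n \<and> (\<forall>i<n. t i \<le> t j)" using fin by auto
  then have "latest < n \<and> (\<forall>i<n. t i \<le> t latest)" unfolding latest_def by (rule someI_ex)
  then show "latest < n" "i < n \<Longrightarrow> t i \<le> t latest" by auto
qed

section \<open>Tour steps crossing a given time\<close>

lemma finite_down [simp]: "finite (down x)" and finite_up [simp]: "finite (up x)"
  and finite_crossing [simp]: "finite (crossing x)"
  by (auto simp: down_def up_def crossing_def)

text \<open>Every counted step toggles whether the tour is after \<open>x\<close>. It starts on the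
  early side, so the two counts differ, by one, exactly when it ends on the late side.\<close>

lemma card_up_aux:
  assumes "t 0 \<le> x"
  shows "card {i\<in>{1..<Suc m}. t (i - 1) \<le> x \<and> x < t i} =
         card {i\<in>{1..<Suc m}. t i \<le> x \<and> x < t (i - 1)} + (if x < t m then 1 else 0)"
proof (induction m)
  case 0
  then show ?case using assms by simp
next
  case (Suc m)
  have split: "{i\<in>{1..<Suc (Suc m)}. P i} = (if P (Suc m) then insert (Suc m) {i\<in>{1..<Suc m}. P i} else {i\<in>{1..<Suc m}. P i})" for P
    by (auto simp: less_Suc_eq)
  show ?case unfolding split[of "\<lambda>i. t (i - 1) \<le> x \<and> x < t i"] split[of "\<lambda>i. t i \<le> x \<and> x < t (i - 1)"]
    using Suc.IH by auto
qed

lemma card_up: "card (up x) \<le> card (down x) + 1"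
proof (cases "t 0 \<le> x")
  case True
  from n_pos obtain m where "n = Suc m" by (cases n) auto
  then have "card (up x) = card (down x) + (if x < t m then 1 else 0)"
    using card_up_aux[OF True, of m] unfolding up_def down_def by simp
  then show ?thesis by simp
next
  case False
  then have "up x = {}" using t0 t_nonneg by (auto simp: up_def) (smt (verit) less_imp_diff_less)
  then show ?thesis by simp
qed

text \<open>The subtracted step is the one that \<open>card_through_le\<close> leaves free. Once all
  requests lie in the past, only the virtual step 0 crosses and both sides vanish.\<close>

lemma card_crossing: "card (crossing x) - 1 \<le> 2 * card (down x)"
proof (cases "\<forall>i<n. t i \<le> x")
  case True
  then have "up x = {}" "down x = {}" by (auto simp: up_def down_def) (smt (verit) less_imp_diff_less)
  then show ?thesis using True by (simp add: crossing_def)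
next
  case False
  then have "crossing x = up x \<union> down x" unfolding crossing_def by (simp only: if_False Un_empty_right)
  then have "card (crossing x) \<le> card (up x) + card (down x)" by (simp add: card_Un_le)
  then show ?thesis using card_up[of x] by simp
qed

lemma stays_prefix: "prefix w z \<Longrightarrow> stays i z \<Longrightarrow> stays i w"
  by (auto simp: stays_def split: if_splits)

text \<open>Both nodes are ancestors of the same leaf.\<close>

lemma stays_comparable: "stays i y \<Longrightarrow> stays i z \<Longrightarrow> prefix y z \<or> prefix z y"
  unfolding stays_def using prefix_same_cases by (metis (full_types))

lemma first_cross:
  assumes "through z x"
  shows "first_cross x z \<in> crossing x" "stays (first_cross x z) z"
proof -
  have "Min {i\<in>crossing x. stays i z} \<in> {i\<in>crossing x. stays i z}"
    using assms by (intro Min_in) (auto simp: through_def)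
  then show "first_cross x z \<in> crossing x" "stays (first_cross x z) z"
    by (auto simp: first_cross_def)
qed

lemma first_cross_le: "i \<in> crossing x \<Longrightarrow> stays i z \<Longrightarrow> first_cross x z \<le> i"
  by (simp add: first_cross_def)

lemma first_cross_antimono:
  assumes "through z x" "prefix w z"
  shows "first_cross x w \<le> first_cross x z"
  using first_cross[OF assms(1)] by (meson assms(2) first_cross_le stays_prefix)

lemma through_prefix: "through z x \<Longrightarrow> prefix w z \<Longrightarrow> through w x"
  unfolding through_def using stays_prefix by blast

lemma first_cross_not_Min:
  assumes "through z x" "prefix w z" "first_cross x z \<noteq> first_cross x w"
  shows "first_cross x z \<in> crossing x - {Min (crossing x)}"
proof -
  have "through w x" using assms through_prefix by blast
  then have "Min (crossing x) \<le> first_cross x w" using first_cross(1) by simp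
  also have "\<dots> < first_cross x z" using first_cross_antimono[OF assms(1,2)] assms(3) by simp
  finally show ?thesis using first_cross(1)[OF assms(1)] by simp
qed

text \<open>Each node \<open>z\<close> of \<open>B\<close> is accompanied by a proper ancestor \<open>w z\<close> and a child \<open>s z\<close> of \<open>w z\<close> off
  the path to \<open>z\<close>. Whenever two crossing tour steps can be told apart below \<open>w z\<close>, the node \<open>z\<close> is
  mapped to one of them that is not the overall minimum, at most two nodes to each step; this is
  why one crossing step remains free of charge.\<close>

lemma card_through_le:
  fixes w s :: "nat list \<Rightarrow> nat list"
  assumes fin: "finite B" and thr: "\<And>z. z \<in> B \<Longrightarrow> through z x"
    and w: "\<And>z. z \<in> B \<Longrightarrow> strict_prefix (w z) z"
    and s: "\<And>z. z \<in> B \<Longrightarrow> s z \<noteq> [] \<and> butlast (s z) = w z \<and> \<not> prefix (s z) z"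
    and sep: "\<And>y z. y \<in> B \<Longrightarrow> z \<in> B \<Longrightarrow> strict_prefix y z \<Longrightarrow> prefix y (w z)"
  shows "card B \<le> 2 * (card (crossing x) - 1) + card {z \<in> s ` B. \<not> through z x}"
proof -
  let ?e = "first_cross x" and ?X = "crossing x - {Min (crossing x)}"
  \<comment> \<open>Either the first crossing step changes between \<open>w z\<close> and
    \<open>z\<close>, or it does not and the side branch \<open>s z\<close> is crossed, or
    \<open>s z\<close> is not crossed. The first two classes each inject into the crossing steps
    other than the minimum, the third one injects via \<open>s\<close>.\<close>
  define B1 where "B1 = {z\<in>B. ?e z \<noteq> ?e (w z)}"
  define B2 where "B2 = {z\<in>B. ?e z = ?e (w z) \<and> through (s z) x}"
  define B3 where "B3 = {z\<in>B. ?e z = ?e (w z) \<and> \<not> through (s z) x}"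
  have pw: "prefix (w z) z" if "z \<in> B" for z using w[OF that] by (simp add: strict_prefix_def)
  have ps: "prefix (w z) (s z)" if "z \<in> B" for z
    using s[OF that] by (metis prefixeq_butlast)
  \<comment> \<open>The two nodes share the first crossing step of their common \<open>w\<close>, so
    they are comparable; if they differed, \<open>sep\<close> would make the upper one a prefix of
    its own proper ancestor.\<close>
  have eqD: "z = y" if "y \<in> B" "z \<in> B" "?e y = ?e (w y)" "?e z = ?e (w z)" "w y = w z" for y z
  proof -
    have "stays (?e y) y" "stays (?e y) z" using first_cross(2) thr that by metis+
    then consider "y = z" | "strict_prefix y z" | "strict_prefix z y"
      using stays_comparable[of _ y z] by (auto simp: strict_prefix_def)
    then show ?thesis
    proof cases
      case 2 then show ?thesis using sep[OF that(1,2)] w[OF that(1)] that(5)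
        by (metis prefix_order.leD)
    next
      case 3 then show ?thesis using sep[OF that(2,1)] w[OF that(2)] that(5)
        by (metis prefix_order.leD)
    qed simp
  qed
  have "card B1 \<le> card ?X"
  proof (rule card_inj_on_le)
    show "?e ` B1 \<subseteq> ?X"
    proof
      fix i assume "i \<in> ?e ` B1"
      then obtain z where "z \<in> B" "?e z \<noteq> ?e (w z)" "i = ?e z" by (auto simp: B1_def)
      then show "i \<in> ?X" using first_cross_not_Min[OF thr pw] by simp
    qed
    \<comment> \<open>Monotonicity squeezes the step of \<open>w z\<close> between two equal ones,
      so it cannot change from \<open>w z\<close> to \<open>z\<close>.\<close>
    have no: False if yz: "y \<in> B1" "z \<in> B1" "?e y = ?e z" "strict_prefix y z" for y z
    proof -
      have B: "y \<in> B" "z \<in> B" using yz by (auto simp: B1_def)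
      have "prefix y (w z)" using sep yz B by blast
      then have "?e y \<le> ?e (w z)" using first_cross_antimono through_prefix thr pw B by blast
      moreover have "?e (w z) \<le> ?e z" using first_cross_antimono thr pw B by blast
      ultimately show False using yz by (auto simp: B1_def)
    qed
    show "inj_on ?e B1"
    proof (rule inj_onI)
      fix y z assume yz: "y \<in> B1" "z \<in> B1" "?e y = ?e z"
      then have "stays (?e y) y" "stays (?e y) z" using first_cross(2) thr
        by (metis (no_types, lifting) B1_def mem_Collect_eq)+
      then consider "y = z" | "strict_prefix y z" | "strict_prefix z y"
        using stays_comparable[of _ y z] by (auto simp: strict_prefix_def)
      then show "y = z" using no[of y z] no[of z y] yz by cases auto
    qed
  qed simp
  moreover have "card B2 \<le> card ?X"
  proof (rule card_inj_on_le)
    \<comment> \<open>A step staying below both \<open>z\<close> and \<open>s z\<close> would make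
      them comparable, but they lie in different branches below \<open>w z\<close>.\<close>
    have ne: "?e (s z) \<noteq> ?e (w z)" if "z \<in> B2" for z
    proof
      assume "?e (s z) = ?e (w z)"
      moreover have z: "z \<in> B" "through (s z) x" "?e z = ?e (w z)" using that by (auto simp: B2_def)
      ultimately have "stays (?e z) (s z)" "stays (?e z) z" using first_cross(2) thr by metis+
      then have "prefix z (s z)" using stays_comparable s z(1) by metis
      then have "prefix z (w z)" using s[OF z(1)] \<open>prefix z (s z)\<close> prefix_snoc
        by (metis append_butlast_last_id prefix_order.refl)
      then show False using w[OF z(1)] by (metis prefix_order.leD)
    qed
    show "(\<lambda>z. ?e (s z)) ` B2 \<subseteq> ?X"
    proof
      fix i assume "i \<in> (\<lambda>z. ?e (s z)) ` B2"
      then obtain z where z: "z \<in> B2" "i = ?e (s z)" by auto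
      then have "z \<in> B" "through (s z) x" by (auto simp: B2_def)
      then show "i \<in> ?X" using first_cross_not_Min[OF _ ps] ne z by simp
    qed
    have no: False if yz: "y \<in> B2" "z \<in> B2" "?e (s y) = ?e (s z)" "strict_prefix (s y) (s z)" for y z
    proof -
      have B: "y \<in> B" "z \<in> B" "through (s y) x" "through (s z) x" using yz by (auto simp: B2_def)
      have "prefix (s y) (w z)" using yz(4) s[OF B(2)]
        by (metis append_butlast_last_id prefix_snoc strict_prefix_def)
      then have "?e (s y) \<le> ?e (w z)" using first_cross_antimono through_prefix ps B by blast
      moreover have "?e (w z) \<le> ?e (s z)" using first_cross_antimono ps B by blast
      ultimately show False using yz ne by (metis nle_le)
    qed
    show "inj_on (\<lambda>z. ?e (s z)) B2"
    proof (rule inj_onI)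
      fix y z assume yz: "y \<in> B2" "z \<in> B2" "?e (s y) = ?e (s z)"
      then have "stays (?e (s y)) (s y)" "stays (?e (s y)) (s z)" using first_cross(2)
        by (metis (no_types, lifting) B2_def mem_Collect_eq)+
      then have "prefix (s y) (s z) \<or> prefix (s z) (s y)" by (rule stays_comparable)
      then have "s y = s z" using no[of y z] no[of z y] yz by (metis strict_prefix_def)
      then have "w y = w z" using s[of y] s[of z] yz by (simp add: B2_def)
      then show "y = z" using eqD yz by (auto simp: B2_def)
    qed
  qed simp
  moreover have "card B3 \<le> card {z \<in> s ` B. \<not> through z x}"
  proof (rule card_inj_on_le)
    show "inj_on s B3"
    proof (rule inj_onI)
      fix y z assume yz: "y \<in> B3" "z \<in> B3" "s y = s z"
      then have "w y = w z" using s[of y] s[of z] by (simp add: B3_def)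
      then show "y = z" using eqD yz by (auto simp: B3_def)
    qed
  qed (use fin in \<open>auto simp: B3_def\<close>)
  moreover have "card B \<le> card B1 + card B2 + card B3"
  proof -
    have "B = B1 \<union> B2 \<union> B3" by (auto simp: B1_def B2_def B3_def)
    then show ?thesis using card_Un_le[of "B1 \<union> B2" B3] card_Un_le[of B1 B2] by simp
  qed
  moreover have "card ?X \<le> card (crossing x) - 1"
    by (cases "crossing x = {}") (simp_all add: Min_in)
  ultimately show ?thesis by linarith
qed

text \<open>Extend a recent request below \<open>z\<close> to a maximal block of tour positions
  below \<open>z\<close> and within the last \<open>2 * theta h z\<close> time units. At either end
  the tour stops, leaves or enters the subtree (paid), passes over \<open>x\<close> inside it
  (excluded, as \<open>z\<close> is not crossed), or goes back before the window. If nothing is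
  paid, the block is a dead end seen from the start of the window.\<close>

lemma charged_cases:
  assumes "charged z x"
  shows "paid z x \<or> dead z (x - 2 * theta h z)"
proof (rule disjCI)
  assume nodead: "\<not> dead z (x - 2 * theta h z)"
  define x' where "x' = x - 2 * theta h z"
  define Q where "Q j \<longleftrightarrow> prefix z (v j) \<and> x' < t j \<and> t j \<le> x" for j
  have nthr: "\<not> through z x" using assms by (simp add: charged_def)
  obtain j0 where j0: "j0 < n" "prefix z (v j0)" "x - theta h z < t j0" "t j0 \<le> x"
    using assms by (auto simp: charged_def active_def)
  have Q0: "Q j0" using j0 theta_pos[of h z] by (simp add: Q_def x'_def)
  define a where "a = (LEAST a. a \<le> j0 \<and> (\<forall>j\<in>{a..j0}. Q j))"
  have "a \<le> j0 \<and> (\<forall>j\<in>{a..j0}. Q j)" unfolding a_def by (rule LeastI[of _ j0]) (use Q0 in auto)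
  then have a: "a \<le> j0" "\<And>j. a \<le> j \<Longrightarrow> j \<le> j0 \<Longrightarrow> Q j" by auto
  have amin: "\<not> Q (a - 1)" if "a > 0"
  proof
    assume "Q (a - 1)"
    then have "a - 1 \<le> j0 \<and> (\<forall>j\<in>{a - 1..j0}. Q j)" using a that
      by (metis Suc_diff_1 Suc_leI atLeastAtMost_iff diff_le_self le_neq_implies_less le_trans)
    then have "a \<le> a - 1" unfolding a_def by (rule Least_le)
    then show False using that by simp
  qed
  define b where "b = (GREATEST b. b < n \<and> j0 \<le> b \<and> (\<forall>j\<in>{j0..b}. Q j))"
  have "b < n \<and> j0 \<le> b \<and> (\<forall>j\<in>{j0..b}. Q j)" unfolding b_def
    by (rule GreatestI_nat[of _ j0 n]) (use Q0 j0 in auto)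
  then have b: "b < n" "j0 \<le> b" "\<And>j. j0 \<le> j \<Longrightarrow> j \<le> b \<Longrightarrow> Q j" by auto
  have bmax: "\<not> Q (Suc b)" if "Suc b < n"
  proof
    assume "Q (Suc b)"
    then have "Suc b < n \<and> j0 \<le> Suc b \<and> (\<forall>j\<in>{j0..Suc b}. Q j)" using b that
      by (auto simp: le_Suc_eq)
    then have "Suc b \<le> b" unfolding b_def by (rule Greatest_le_nat[of _ _ n]) auto
    then show False by simp
  qed
  have Qab: "Q j" if "a \<le> j" "j \<le> b" for j using a b that nat_le_linear by blast
  show "paid z x"
  proof (rule ccontr)
    assume npaid: "\<not> paid z x"
    have low_a: "a = 0 \<or> t (a - 1) \<le> x'"
    proof (rule disjCI)
      assume "\<not> t (a - 1) \<le> x'"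
      show "a = 0"
      proof (rule ccontr)
        assume "a \<noteq> 0"
        then have i: "a \<in> {1..<n}" using a b by auto
        have Qa: "Q a" using a by simp
        show False
        proof (cases "prefix z (v (a - 1))")
          case True
          then have "x < t (a - 1)" using amin \<open>a \<noteq> 0\<close> \<open>\<not> t (a - 1) \<le> x'\<close> by (auto simp: Q_def)
          then have "a \<in> crossing x" using Qa i by (auto simp: crossing_def down_def Q_def)
          moreover have "stays a z" using True Qa \<open>a \<noteq> 0\<close> by (simp add: stays_def Q_def)
          ultimately show False using nthr by (auto simp: through_def)
        next
          case False
          then show False using npaid i Qa by (auto simp: paid_def Q_def x'_def)
        qed
      qed
    qed
    have low_b: "t (Suc b) \<le> x'" if sb: "Suc b < n"
    proof (rule ccontr)
      assume "\<not> t (Suc b) \<le> x'"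
      have i: "Suc b \<in> {1..<n}" using sb by auto
      have Qb: "Q b" using b by simp
      show False
      proof (cases "prefix z (v (Suc b))")
        case True
        then have "x < t (Suc b)" using bmax sb \<open>\<not> t (Suc b) \<le> x'\<close> by (auto simp: Q_def)
        then have "Suc b \<in> crossing x" using Qb i by (auto simp: crossing_def up_def Q_def)
        moreover have "stays (Suc b) z" using True Qb by (simp add: stays_def Q_def)
        ultimately show False using nthr by (auto simp: through_def)
      next
        case False
        have "\<exists>i\<in>{1..<n}. prefix z (v (i - 1)) \<and> \<not> prefix z (v i) \<and> t (i - 1) \<le> x \<and> x < t (i - 1) + 2 * theta h z"
          by (rule bexI[OF _ i]) (use False Qb in \<open>auto simp: Q_def x'_def\<close>)
        then show False using npaid by (auto simp: paid_def)
      qed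
    qed
    have "run x' a b" using a b Qab low_a low_b by (auto simp: run_def Q_def)
    moreover have "\<forall>j\<in>{a..b}. prefix z (v j) \<and> t j \<le> x' + 2 * theta h z"
      using Qab by (auto simp: Q_def x'_def)
    moreover have "\<exists>j\<in>{a..b}. x' + theta h z < t j"
      by (rule bexI[of _ j0]) (use j0 a b in \<open>auto simp: x'_def\<close>)
    ultimately have all: "t j \<le> x'" if "j < n" "j \<notin> {a..b}" for j
      using nodead a b that unfolding dead_def x'_def[symmetric] by (meson le_trans not_less)
    have x'x: "x' \<le> x" using theta_pos[of h z] by (simp add: x'_def)
    have "t j \<le> x" if "j < n" for j
      using all[OF that] x'x Qab by (cases "j \<in> {a..b}") (auto simp: Q_def)
    then have "0 \<in> crossing x" by (simp add: crossing_def)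
    moreover have "latest \<in> {a..b}"
    proof (rule ccontr)
      assume "latest \<notin> {a..b}"
      then have "t latest \<le> x'" using all latest by blast
      then show False using latest(2)[OF j0(1)] Q0 by (simp add: Q_def)
    qed
    then have "stays 0 z" using Qab by (auto simp: stays_def Q_def)
    ultimately show False using nthr by (auto simp: through_def)
  qed
qed

section \<open>Counting dead ends by backward steps\<close>

lemma ex_down:
  assumes "j \<le> k" "k < n" "x < t j" "t k \<le> x"
  shows "\<exists>i. j < i \<and> i \<le> k \<and> i \<in> down x"
  using assms
proof (induction "k - j" arbitrary: k)
  case 0
  then show ?case by simp
next
  case (Suc d)
  then have jk: "j < k" by simp
  show ?case
  proof (cases "t (k - 1) \<le> x")
    case True
    have "d = k - 1 - j" "j \<le> k - 1" "k - 1 < n" using Suc.hyps Suc.prems jk by auto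
    from Suc(1)[OF this Suc.prems(3) True] show ?thesis by (metis diff_le_self le_trans)
  next
    case False
    then have "k \<in> down x" using Suc.prems jk by (auto simp: down_def)
    then show ?thesis using jk by auto
  qed
qed

lemma run_start_unique: "run x a b \<Longrightarrow> run x a' b \<Longrightarrow> a = a'"
proof (induction a a' rule: linorder_wlog)
  case (le a a')
  show ?case
  proof (rule ccontr)
    assume "a \<noteq> a'"
    then have "a' - 1 \<in> {a..b}" "a' \<noteq> 0" using le by (auto simp: run_def)
    then show False using le unfolding run_def by (metis not_less)
  qed
qed auto

text \<open>Periods double from level to level, so the windows after \<open>x\<close> belonging to
  different levels are disjoint, and the latest time of the block fixes the level. The leaf
  \<open>v a\<close> then fixes the node.\<close>

lemma dead_node_unique:
  assumes "run x a b" "length y \<le> h" "length z \<le> h"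
    and "\<forall>j\<in>{a..b}. prefix y (v j) \<and> t j \<le> x + 2 * theta h y" "\<exists>j\<in>{a..b}. x + theta h y < t j"
    and "\<forall>j\<in>{a..b}. prefix z (v j) \<and> t j \<le> x + 2 * theta h z" "\<exists>j\<in>{a..b}. x + theta h z < t j"
  shows "y = z"
proof -
  have *: "\<not> length z < length y" if "length y \<le> h" "\<exists>j\<in>{a..b}. x + theta h z < t j"
    "\<forall>j\<in>{a..b}. t j \<le> x + 2 * theta h y" for y z
  proof
    assume l: "length z < length y"
    have "(2::real) * 2 ^ (h - length y) = 2 ^ Suc (h - length y)" by simp
    also have "\<dots> \<le> 2 ^ (h - length z)" using l that by (intro power_increasing) auto
    finally have "2 * theta h y \<le> theta h z" by (simp add: theta_def)
    then show False using that by force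
  qed
  have "length y = length z" using *[of y z] *[of z y] assms by (meson linorder_neqE_nat)
  moreover have "prefix y (v a)" "prefix z (v a)" using assms by (auto simp: run_def)
  ultimately show ?thesis by (metis prefix_def append_eq_append_conv)
qed

text \<open>A dead node is determined by the end of its block. Either the tour steps back across
  \<open>x\<close> right after that end, or the block ends the tour; the latter happens for at most
  one node, and only if some backward step exists.\<close>

lemma card_dead_le: "card {z\<in>nodes. dead z x} \<le> 2 * card (down x)"
proof -
  let ?P = "\<lambda>z b a. a \<le> b \<and> run x a b \<and> (\<forall>j\<in>{a..b}. prefix z (v j) \<and> t j \<le> x + 2 * theta h z) \<and>
     (\<exists>j\<in>{a..b}. x + theta h z < t j) \<and> (\<exists>j<n. j \<notin> {a..b} \<and> x < t j)"
  let ?D = "{z\<in>nodes. dead z x}"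
  have "\<forall>z\<in>?D. \<exists>b a. b < n \<and> ?P z b a" unfolding dead_def by blast
  then obtain b where "\<forall>z\<in>?D. \<exists>a. b z < n \<and> ?P z (b z) a" by (rule bchoice[THEN exE])
  then obtain a where ab: "\<forall>z\<in>?D. b z < n \<and> ?P z (b z) (a z)" by (rule bchoice[THEN exE])
  have len: "length z \<le> h" if "z \<in> nodes" for z
    using that leaf prefix_length_le by (fastforce simp: nodes_def)
  have inj: "inj_on b ?D"
  proof (rule inj_onI)
    fix y z assume yz: "y \<in> ?D" "z \<in> ?D" "b y = b z"
    then have "a y = a z" using ab run_start_unique by metis
    moreover have "?P y (b y) (a y)" "?P z (b z) (a z)" "length y \<le> h" "length z \<le> h"
      using yz ab len by blast+
    ultimately show "y = z" using dead_node_unique[of x "a y" "b y" y z] yz(3) by metis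
  qed
  let ?D1 = "{z\<in>?D. Suc (b z) < n}" and ?D2 = "{z\<in>?D. \<not> Suc (b z) < n}"
  have fin: "finite ?D" using finite_nodes by simp
  have "card ?D1 \<le> card (down x)"
  proof (rule card_inj_on_le)
    show "inj_on (\<lambda>z. Suc (b z)) ?D1" using inj by (auto simp: inj_on_def)
    show "(\<lambda>z. Suc (b z)) ` ?D1 \<subseteq> down x" using ab by (auto simp: down_def run_def)
  qed simp
  moreover have "card ?D2 \<le> card (down x)"
  proof (cases "?D2 = {}")
    case True
    then show ?thesis by (simp only: card.empty)
  next
    case False
    then obtain z where z: "z \<in> ?D" "\<not> Suc (b z) < n" by auto
    then have "?P z (b z) (a z)" "b z < n" using ab by auto
    then obtain j where j: "j < n" "j \<notin> {a z..b z}" "x < t j" by blast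
    \<comment> \<open>The block reaches the last position, so the other late request comes before
      it, and the tour has to step back between \<open>j\<close> and \<open>a z - 1\<close>.\<close>
    then have ja: "j < a z" using z by auto
    moreover have "run x (a z) (b z)" using ab z by auto
    ultimately have "t (a z - 1) \<le> x" "a z - 1 < n" by (auto simp: run_def)
    then have "down x \<noteq> {}" using ex_down[of j "a z - 1" x] ja j by (auto dest: less_imp_Suc_add)
    then have "card (down x) \<ge> 1" by (simp add: Suc_le_eq card_gt_0_iff)
    moreover have "card ?D2 \<le> 1"
    proof (rule card_le_Suc0_iff_eq[THEN iffD2, simplified One_nat_def[symmetric]])
      show "finite ?D2" using fin by (rule rev_finite_subset) auto
      show "\<forall>y\<in>?D2. \<forall>z\<in>?D2. y = z"
      proof (intro ballI)
        fix y z assume "y \<in> ?D2" "z \<in> ?D2"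
        moreover from this have "b y < n" "b z < n" using ab by auto
        ultimately have "b y = b z" "y \<in> ?D" "z \<in> ?D" by auto
        then show "y = z" by (rule inj_onD[OF inj])
      qed
    qed
    ultimately show ?thesis by simp
  qed
  moreover have "card ?D \<le> card ?D1 + card ?D2"
  proof -
    have "?D = ?D1 \<union> ?D2" by auto
    then have "card ?D = card (?D1 \<union> ?D2)" by (rule arg_cong)
    then show ?thesis using card_Un_le[of ?D1 ?D2] by linarith
  qed
  ultimately show ?thesis by linarith
qed

end

section \<open>Tree distance and Lebesgue measure\<close>

lemma take_lcp_len: "take (lcp_len x y) x = take (lcp_len x y) y"
  by (induction x y rule: lcp_len.induct) auto

lemma lcp_len_commute: "lcp_len x y = lcp_len y x"
  by (induction x y rule: lcp_len.induct) auto

lemma lcp_len_less: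
  assumes "prefix z x" "\<not> prefix z y"
  shows "lcp_len x y < length z"
proof (rule ccontr)
  assume "\<not> lcp_len x y < length z"
  then have "prefix z (take (lcp_len x y) x)" using assms(1)
    by (metis not_less prefix_def prefix_length_le prefix_length_prefix take_is_prefix
        length_take min_def)
  then show False using assms(2) take_lcp_len[of x y] by (metis prefix_order.trans take_is_prefix)
qed

text \<open>These nodes lie on the path from \<open>x\<close> up to just below the lowest common
  ancestor, and each contributes four times the edge above it.\<close>

lemma sum_theta_le:
  assumes "finite F"
  shows "(\<Sum>z\<in>{z\<in>F. prefix z x \<and> \<not> prefix z y}. theta h z)
    \<le> 4 * (\<Sum>k\<in>{lcp_len x y..<length x}. 2 ^ (h - Suc k))"
proof -
  let ?K = "{lcp_len x y..<length x}"
  \<comment> \<open>The index \<open>k\<close> is the depth of the upper end of an edge; its lower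
    end is \<open>take (Suc k) x\<close>.\<close>
  have "{z\<in>F. prefix z x \<and> \<not> prefix z y} \<subseteq> (\<lambda>k. take (Suc k) x) ` ?K"
  proof
    fix z assume "z \<in> {z\<in>F. prefix z x \<and> \<not> prefix z y}"
    then have z: "prefix z x" "lcp_len x y < length z" using lcp_len_less by auto
    then have "z = take (Suc (length z - 1)) x" by (auto simp: prefix_def)
    moreover have "length z - 1 \<in> ?K" using z prefix_length_le[OF z(1)] by auto
    ultimately show "z \<in> (\<lambda>k. take (Suc k) x) ` ?K" by blast
  qed
  then have "(\<Sum>z\<in>{z\<in>F. prefix z x \<and> \<not> prefix z y}. theta h z) \<le> (\<Sum>z\<in>(\<lambda>k. take (Suc k) x) ` ?K. theta h z)"
    by (intro sum_mono2) (auto simp: theta_pos less_imp_le)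
  also have "\<dots> = (\<Sum>k\<in>?K. theta h (take (Suc k) x))"
  proof (subst sum.reindex)
    show "inj_on (\<lambda>k. take (Suc k) x) ?K"
    proof (rule inj_onI)
      fix j k assume "j \<in> ?K" "k \<in> ?K" "take (Suc j) x = take (Suc k) x"
      moreover from this have "length (take (Suc j) x) = length (take (Suc k) x)" by simp
      ultimately show "j = k" unfolding length_take by simp
    qed
  qed simp
  also have "\<dots> = (\<Sum>k\<in>?K. 4 * 2 ^ (h - Suc k))" by (intro sum.cong) (auto simp: theta_def min_def)
  finally show ?thesis by (simp add: sum_distrib_left)
qed

lemma dT_nonneg: "0 \<le> dT h x y"
  by (simp add: dT_def sum_nonneg)

lemma sets_borel_shift:
  fixes c :: real
  assumes "{x. P x} \<in> sets borel"
  shows "{x. P (x - c)} \<in> sets borel"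
proof -
  have "(\<lambda>x. x - c) -` {x. P x} \<inter> space borel \<in> sets borel"
    using assms by (intro measurable_sets[of _ borel borel]) auto
  then show ?thesis by (simp add: vimage_def)
qed

lemma emeasure_lborel_shift:
  fixes c :: real
  assumes "{x. P x} \<in> sets borel"
  shows "emeasure lborel {x. P (x - c)} = emeasure lborel {x. P x}"
proof -
  note m = sets_borel_shift[OF assms, of c]
  have "emeasure lborel {x. P (x - c)} = emeasure (distr lborel borel ((+) c)) {x. P (x - c)}"
    by (simp add: lborel_distr_plus)
  also have "\<dots> = emeasure lborel ((+) c -` {x. P (x - c)} \<inter> space lborel)"
    using m by (intro emeasure_distr) auto
  finally show ?thesis by (simp add: vimage_def)
qed

lemma card_eq_sum_indicator:
  assumes "finite F"
  shows "ennreal (real (card {i\<in>F. P i x})) = (\<Sum>i\<in>F. indicator {x. P i x} x)"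
proof -
  have "(\<Sum>i\<in>F. indicator {x. P i x} x) = (\<Sum>i\<in>F. if P i x then 1 else 0 :: ennreal)"
    by (intro sum.cong) (auto simp: indicator_def)
  also have "\<dots> = ennreal (real (card {i\<in>F. P i x}))"
    using assms by (simp add: sum.If_cases Int_def ennreal_of_nat_eq_real_of_nat)
  finally show ?thesis by simp
qed

text \<open>Turns a bound on the number of simultaneous events into a bound on the sum of their
  durations.\<close>

lemma nn_integral_card:
  fixes P :: "'i \<Rightarrow> real \<Rightarrow> bool"
  assumes "finite F" "\<And>i. i \<in> F \<Longrightarrow> {x. P i x} \<in> sets borel"
  shows "(\<integral>\<^sup>+ x. ennreal (real (card {i\<in>F. P i x})) \<partial>lborel) = (\<Sum>i\<in>F. emeasure lborel {x. P i x})"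
  unfolding card_eq_sum_indicator[OF assms(1)] using assms(2)
  by (subst nn_integral_sum) (auto intro!: sum.cong)

section \<open>Durations bounded by the cost of the tour\<close>

context tour
begin

definition tour_cost :: real where
  "tour_cost = (\<Sum>i\<in>{1..<n}. max (dT h (v (i - 1)) (v i)) (t (i - 1) - t i))"

lemma sum_dT_le: "(\<Sum>i\<in>{1..<n}. dT h (v (i - 1)) (v i)) \<le> tour_cost"
  unfolding tour_cost_def by (intro sum_mono) simp

lemma tour_cost_nonneg: "0 \<le> tour_cost"
  unfolding tour_cost_def by (intro sum_nonneg) (simp add: dT_nonneg max.coboundedI1)

lemma nn_integral_down: "(\<integral>\<^sup>+ x. ennreal (real (card (down x))) \<partial>lborel) \<le> ennreal tour_cost"
proof -
  have *: "{x. t i \<le> x \<and> x < t (i - 1)} = {t i..<t (i - 1)}" for i by auto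
  have "(\<integral>\<^sup>+ x. ennreal (real (card (down x))) \<partial>lborel)
    = (\<Sum>i\<in>{1..<n}. emeasure lborel {x. t i \<le> x \<and> x < t (i - 1)})"
    unfolding down_def by (rule nn_integral_card) (auto simp: *)
  also have "\<dots> = (\<Sum>i\<in>{1..<n}. ennreal (max 0 (t (i - 1) - t i)))"
    unfolding * by (intro sum.cong) (auto simp: max_def)
  also have "\<dots> = ennreal (\<Sum>i\<in>{1..<n}. max 0 (t (i - 1) - t i))"
    by (rule sum_ennreal) simp
  also have "\<dots> \<le> ennreal tour_cost" unfolding tour_cost_def
    by (intro ennreal_leI sum_mono max.mono dT_nonneg order_refl)
  finally show ?thesis .
qed

lemma sets_paid [measurable]: "{x. paid z x} \<in> sets borel"
  unfolding paid_def by measurable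

lemma sets_dead [measurable]: "{x. dead z x} \<in> sets borel"
  unfolding dead_def run_def by measurable

lemma sets_charged [measurable]: "{x. charged z x} \<in> sets borel"
proof -
  \<comment> \<open>An explicit pointwise condition, which \<open>measurable\<close> can
    decompose.\<close>
  have "crossing x = {i. i \<in> {1..<n} \<and> (t (i - 1) \<le> x \<and> x < t i \<or> t i \<le> x \<and> x < t (i - 1)) \<or>
      i = 0 \<and> (\<forall>i<n. t i \<le> x)}" for x
    by (auto simp: crossing_def up_def down_def)
  then show ?thesis unfolding charged_def active_def through_def Bex_def by simp measurable
qed

text \<open>Step \<open>i\<close> opens one window of length \<open>2 * theta h z\<close> for each
  node \<open>z\<close> separating its endpoints. As \<open>theta\<close> is four edge lengths, the
  windows of a step add up to at most 8 times its distance.\<close>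

lemma sum_emeasure_paid:
  "(\<Sum>z\<in>nodes. emeasure lborel {x. paid z x}) \<le> ennreal (8 * (\<Sum>i\<in>{1..<n}. dT h (v (i - 1)) (v i)))"
proof -
  define A where "A z i = (if prefix z (v i) \<and> \<not> prefix z (v (i - 1)) then {t i..<t i + 2 * theta h z} else {})" for z i
  define B where "B z i = (if prefix z (v (i - 1)) \<and> \<not> prefix z (v i) then {t (i - 1)..<t (i - 1) + 2 * theta h z} else {})" for z i
  have eq: "{x. paid z x} = (\<Union>i\<in>{1..<n}. A z i \<union> B z i)" for z
  proof (rule set_eqI)
    fix x
    have "x \<in> A z i \<longleftrightarrow> prefix z (v i) \<and> \<not> prefix z (v (i - 1)) \<and> t i \<le> x \<and> x < t i + 2 * theta h z"
      "x \<in> B z i \<longleftrightarrow> prefix z (v (i - 1)) \<and> \<not> prefix z (v i) \<and> t (i - 1) \<le> x \<and> x < t (i - 1) + 2 * theta h z" for i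
      by (auto simp: A_def B_def)
    then show "x \<in> {x. paid z x} \<longleftrightarrow> x \<in> (\<Union>i\<in>{1..<n}. A z i \<union> B z i)"
      unfolding paid_def mem_Collect_eq UN_iff Un_iff by simp
  qed
  have AB: "A z i \<in> sets lborel" "B z i \<in> sets lborel" for z i by (auto simp: A_def B_def)
  have "emeasure lborel {x. paid z x} \<le> (\<Sum>i\<in>{1..<n}. emeasure lborel (A z i) + emeasure lborel (B z i))" for z
  proof -
    have "emeasure lborel {x. paid z x} \<le> (\<Sum>i\<in>{1..<n}. emeasure lborel (A z i \<union> B z i))"
      unfolding eq by (rule emeasure_subadditive_finite) (use AB in auto)
    also have "\<dots> \<le> (\<Sum>i\<in>{1..<n}. emeasure lborel (A z i) + emeasure lborel (B z i))"
      by (intro sum_mono emeasure_subadditive AB)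
    finally show ?thesis .
  qed
  then have "(\<Sum>z\<in>nodes. emeasure lborel {x. paid z x})
     \<le> (\<Sum>z\<in>nodes. \<Sum>i\<in>{1..<n}. emeasure lborel (A z i) + emeasure lborel (B z i))"
    by (rule sum_mono)
  also have "\<dots> = (\<Sum>i\<in>{1..<n}. (\<Sum>z\<in>nodes. emeasure lborel (A z i)) + (\<Sum>z\<in>nodes. emeasure lborel (B z i)))"
    by (subst sum.swap) (simp add: sum.distrib)
  also have "\<dots> \<le> (\<Sum>i\<in>{1..<n}. ennreal (8 * dT h (v (i - 1)) (v i)))"
  proof (rule sum_mono)
    fix i
    have split: "(\<Sum>z\<in>nodes. if prefix z x \<and> \<not> prefix z y then ennreal (2 * theta h z) else 0)
       \<le> ennreal (8 * (\<Sum>k\<in>{lcp_len x y..<length x}. 2 ^ (h - Suc k)))" for x y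
    proof -
      have "(\<Sum>z\<in>nodes. if prefix z x \<and> \<not> prefix z y then ennreal (2 * theta h z) else 0)
        = (\<Sum>z\<in>{z\<in>nodes. prefix z x \<and> \<not> prefix z y}. ennreal (2 * theta h z))"
        using finite_nodes by (simp add: sum.inter_filter)
      also have "\<dots> = ennreal (2 * (\<Sum>z\<in>{z\<in>nodes. prefix z x \<and> \<not> prefix z y}. theta h z))"
        by (subst sum_ennreal) (simp_all add: theta_pos less_imp_le sum_distrib_left)
      also have "\<dots> \<le> ennreal (8 * (\<Sum>k\<in>{lcp_len x y..<length x}. 2 ^ (h - Suc k)))"
        using sum_theta_le[OF finite_nodes, where x=x and y=y and h=h] by (intro ennreal_leI) simp
      finally show ?thesis .
    qed
    have "emeasure lborel (A z i) = (if prefix z (v i) \<and> \<not> prefix z (v (i - 1)) then ennreal (2 * theta h z) else 0)"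
      "emeasure lborel (B z i) = (if prefix z (v (i - 1)) \<and> \<not> prefix z (v i) then ennreal (2 * theta h z) else 0)" for z
      using theta_pos[of h z] by (auto simp: A_def B_def)
    then have "(\<Sum>z\<in>nodes. emeasure lborel (A z i)) + (\<Sum>z\<in>nodes. emeasure lborel (B z i))
      \<le> ennreal (8 * (\<Sum>k\<in>{lcp_len (v i) (v (i - 1))..<length (v i)}. 2 ^ (h - Suc k)))
       + ennreal (8 * (\<Sum>k\<in>{lcp_len (v (i - 1)) (v i)..<length (v (i - 1))}. 2 ^ (h - Suc k)))"
      by (simp only:) (intro add_mono split)
    also have "\<dots> = ennreal (8 * dT h (v (i - 1)) (v i))"
      unfolding dT_def lcp_len_commute[of "v i"]
      by (subst ennreal_plus[symmetric]) (simp_all add: sum_nonneg algebra_simps)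
    finally show "(\<Sum>z\<in>nodes. emeasure lborel (A z i)) + (\<Sum>z\<in>nodes. emeasure lborel (B z i))
      \<le> ennreal (8 * dT h (v (i - 1)) (v i))" .
  qed
  also have "\<dots> = ennreal (8 * (\<Sum>i\<in>{1..<n}. dT h (v (i - 1)) (v i)))"
    by (subst sum_ennreal) (simp_all add: dT_nonneg sum_distrib_left)
  finally show ?thesis .
qed

lemma sum_emeasure_dead: "(\<Sum>z\<in>nodes. emeasure lborel {x. dead z x}) \<le> ennreal (2 * tour_cost)"
proof -
  have "(\<Sum>z\<in>nodes. emeasure lborel {x. dead z x}) = (\<integral>\<^sup>+ x. ennreal (real (card {z\<in>nodes. dead z x})) \<partial>lborel)"
    by (rule nn_integral_card[symmetric]) (simp_all add: finite_nodes sets_dead)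
  also have "\<dots> \<le> (\<integral>\<^sup>+ x. 2 * ennreal (real (card (down x))) \<partial>lborel)"
  proof (rule nn_integral_mono)
    fix x
    have "real (card {z\<in>nodes. dead z x}) \<le> 2 * real (card (down x))" using card_dead_le[of x] by linarith
    then have "ennreal (real (card {z\<in>nodes. dead z x})) \<le> ennreal (2 * real (card (down x)))" by (rule ennreal_leI)
    then show "ennreal (real (card {z\<in>nodes. dead z x})) \<le> 2 * ennreal (real (card (down x)))"
      by (simp add: ennreal_mult)
  qed
  also have "\<dots> = 2 * (\<integral>\<^sup>+ x. ennreal (real (card (down x))) \<partial>lborel)"
  proof (rule nn_integral_cmult)
    have "{x. t i \<le> x \<and> x < t (i - 1)} = {t i..<t (i - 1)}" for i by auto
    then show "(\<lambda>x. ennreal (real (card (down x)))) \<in> borel_measurable lborel"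
      unfolding down_def card_eq_sum_indicator[OF finite_atLeastLessThan] by auto
  qed
  also have "\<dots> \<le> 2 * ennreal tour_cost" by (intro mult_left_mono nn_integral_down) simp
  finally show ?thesis using tour_cost_nonneg by (simp add: ennreal_mult)
qed

text \<open>The shift by \<open>2 * theta h z\<close> in \<open>charged_cases\<close> depends on
  \<open>z\<close>, but translation preserves the measure of each set separately. The constant is 8
  for travel plus 2 for dead ends.\<close>

lemma sum_emeasure_charged: "(\<Sum>z\<in>nodes. emeasure lborel {x. charged z x}) \<le> ennreal (10 * tour_cost)"
proof -
  have "emeasure lborel {x. charged z x} \<le> emeasure lborel {x. paid z x} + emeasure lborel {x. dead z x}" for z
  proof -
    have "emeasure lborel {x. charged z x} \<le> emeasure lborel ({x. paid z x} \<union> {x. dead z (x - 2 * theta h z)})"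
      using sets_borel_shift[OF sets_dead] sets_paid charged_cases by (intro emeasure_mono) auto
    also have "\<dots> \<le> emeasure lborel {x. paid z x} + emeasure lborel {x. dead z (x - 2 * theta h z)}"
      using sets_borel_shift[OF sets_dead] sets_paid by (intro emeasure_subadditive) auto
    finally show ?thesis by (simp add: emeasure_lborel_shift[OF sets_dead])
  qed
  then have "(\<Sum>z\<in>nodes. emeasure lborel {x. charged z x})
    \<le> (\<Sum>z\<in>nodes. emeasure lborel {x. paid z x} + emeasure lborel {x. dead z x})"
    by (rule sum_mono)
  also have "\<dots> \<le> ennreal (8 * (\<Sum>i\<in>{1..<n}. dT h (v (i - 1)) (v i))) + ennreal (2 * tour_cost)"
    unfolding sum.distrib by (intro add_mono sum_emeasure_paid sum_emeasure_dead)
  also have "\<dots> \<le> ennreal (8 * tour_cost) + ennreal (2 * tour_cost)"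
    using sum_dT_le by (intro add_mono ennreal_leI) auto
  also have "\<dots> = ennreal (10 * tour_cost)"
    using tour_cost_nonneg by (subst ennreal_plus[symmetric]) auto
  finally show ?thesis .
qed

text \<open>A node that is inactive and not crossed by the tour stays so since its last request, and it was
  charged for a whole period of length \<^term>\<open>theta h z\<close> right after that request. So a condition that
  holds for only a bounded time between two requests below \<open>z\<close> can be paid for by that period.\<close>

lemma idle_bound:
  assumes P: "\<And>x y. P x \<Longrightarrow> P y \<Longrightarrow> x \<le> y \<Longrightarrow>
      (\<And>j. j < n \<Longrightarrow> prefix z (v j) \<Longrightarrow> x - theta h z < t j \<Longrightarrow> t j \<le> y \<Longrightarrow> False) \<Longrightarrow>
      y \<le> x + theta h z / 2"
  shows "\<exists>S\<in>sets borel. (\<forall>x. P x \<and> \<not> through z x \<and> \<not> active z x \<and> (\<exists>j<n. prefix z (v j) \<and> t j \<le> x) \<longrightarrow> x \<in> S) \<and>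
     emeasure lborel S \<le> emeasure lborel {x. charged z x}"
proof -
  define T where "T = t ` {j. j < n \<and> prefix z (v j)}"
  \<comment> \<open>The idle times are grouped by the time \<open>b\<close> of the last request
    below \<open>z\<close> before them.\<close>
  define G where "G b = {x. P x \<and> \<not> through z x \<and> \<not> active z x \<and> b \<le> x \<and> (\<forall>s\<in>T. s \<le> x \<longrightarrow> s \<le> b)}" for b
  define Tb where "Tb = {b\<in>T. G b \<noteq> {}}"
  let ?\<theta> = "theta h z"
  have finT: "finite T" by (simp add: T_def)
  then have finTb: "finite Tb" by (simp add: Tb_def)
  define g where "g b = (SOME x. x \<in> G b)" for b
  have g: "g b \<in> G b" if "b \<in> Tb" for b using that by (auto simp: Tb_def g_def some_in_eq)
  have idle: "b + ?\<theta> \<le> x" if "b \<in> T" "x \<in> G b" for b x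
    using that by (auto simp: G_def T_def active_def not_less)
  have diam: "y \<le> x + ?\<theta> / 2" if b: "b \<in> T" "x \<in> G b" "y \<in> G b" "x \<le> y" for b x y
  proof (rule P)
    fix j assume j: "j < n" "prefix z (v j)" "x - ?\<theta> < t j" "t j \<le> y"
    then have "t j \<in> T" by (auto simp: T_def)
    then have "t j \<le> b" using j b by (auto simp: G_def)
    then show False using idle[OF b(1,2)] j by simp
  qed (use b in \<open>auto simp: G_def\<close>)
  \<comment> \<open>\<open>P\<close> is arbitrary, so each group is covered by an interval of length
    \<open>theta h z\<close>: all its points lie within half of that from the chosen point
    \<open>g b\<close>.\<close>
  define S where "S = (\<Union>b\<in>Tb. {g b - ?\<theta> / 2..g b + ?\<theta> / 2})"
  \<comment> \<open>Nothing is issued below \<open>z\<close> after \<open>b\<close> up to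
    \<open>g b\<close>. Hence a step crossing \<open>x\<close> inside the subtree would cross
    \<open>g b\<close> as well, where \<open>z\<close> is not crossed.\<close>
  have ch: "charged z x" if b: "b \<in> Tb" "b \<le> x" "x < b + ?\<theta>" for b x
  proof -
    have bT: "b \<in> T" and gb: "g b \<in> G b" using b g by (auto simp: Tb_def)
    have xg: "x < g b" using idle[OF bT gb] b by simp
    have "active z x" using bT b by (auto simp: active_def T_def)
    moreover have "\<not> through z x"
    proof
      assume "through z x"
      then obtain i where i: "i \<in> crossing x" "stays i z" by (auto simp: through_def)
      have late: "g b < t j" if "j < n" "prefix z (v j)" "x < t j" for j
      proof (rule ccontr)
        assume "\<not> g b < t j"
        moreover have "t j \<in> T" using that by (auto simp: T_def)
        ultimately have "t j \<le> b" using gb by (auto simp: G_def)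
        then show False using that b by simp
      qed
      have "i \<in> crossing (g b)"
      proof (cases "i = 0")
        case True
        then have "\<forall>j<n. t j \<le> x" using i by (auto simp: crossing_def up_def down_def split: if_splits)
        then have "\<forall>j<n. t j \<le> g b" using xg by force
        then show ?thesis using True by (simp add: crossing_def)
      next
        case False
        then have "i \<in> {1..<n}" "prefix z (v i)" "prefix z (v (i - 1))"
          "t (i - 1) \<le> x \<and> x < t i \<or> t i \<le> x \<and> x < t (i - 1)"
          using i by (auto simp: crossing_def up_def down_def stays_def split: if_splits)
        then show ?thesis using late[of i] late[of "i - 1"] xg
          by (auto simp: crossing_def up_def down_def less_imp_diff_less)
      qed
      then show False using i(2) gb by (auto simp: through_def G_def)
    qed
    ultimately show ?thesis by (simp add: charged_def)
  qed
  have "emeasure lborel S \<le> (\<Sum>b\<in>Tb. emeasure lborel {g b - ?\<theta> / 2..g b + ?\<theta> / 2})"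
    unfolding S_def by (rule emeasure_subadditive_finite) (use finTb in auto)
  also have "\<dots> = (\<Sum>b\<in>Tb. emeasure lborel {b..<b + ?\<theta>})"
    using theta_pos[of h z] by (intro sum.cong) auto
  also have "\<dots> = emeasure lborel (\<Union>b\<in>Tb. {b..<b + ?\<theta>})"
  proof (rule sum_emeasure)
    \<comment> \<open>The next request below \<open>z\<close> comes after \<open>g b\<close>, hence
      after the whole period that starts at \<open>b\<close>.\<close>
    have lt: "b + ?\<theta> \<le> c" if "b \<in> Tb" "c \<in> Tb" "b < c" for b c
    proof -
      have "b \<in> T" "c \<in> T" "g b \<in> G b" using that g by (auto simp: Tb_def)
      then show ?thesis using idle[of b "g b"] that by (force simp: G_def)
    qed
    show "disjoint_family_on (\<lambda>b. {b..<b + ?\<theta>}) Tb"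
      unfolding disjoint_family_on_def using lt by (fastforce simp: neq_iff)
  qed (use finTb in auto)
  also have "\<dots> \<le> emeasure lborel {x. charged z x}"
    by (rule emeasure_mono) (use ch sets_charged in auto)
  finally have "emeasure lborel S \<le> emeasure lborel {x. charged z x}" .
  moreover have "S \<in> sets borel" unfolding S_def using finTb by auto
  moreover have "x \<in> S" if x: "P x" "\<not> through z x" "\<not> active z x" "j < n" "prefix z (v j)" "t j \<le> x" for x j
  proof -
    define b where "b = Max {s\<in>T. s \<le> x}"
    have ne: "finite {s\<in>T. s \<le> x}" "{s\<in>T. s \<le> x} \<noteq> {}" using x finT by (auto simp: T_def)
    have "b \<in> {s\<in>T. s \<le> x}" unfolding b_def using ne by (rule Max_in)
    moreover have "\<forall>s\<in>T. s \<le> x \<longrightarrow> s \<le> b" unfolding b_def using ne by auto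
    ultimately have xb: "b \<in> T" "x \<in> G b" using x by (auto simp: G_def)
    then have b: "b \<in> Tb" by (auto simp: Tb_def)
    have "x \<le> g b + ?\<theta> / 2 \<and> g b - ?\<theta> / 2 \<le> x"
      using diam[OF xb(1) xb(2) g[OF b]] diam[OF xb(1) g[OF b] xb(2)] theta_pos[of h z]
      by (cases "x \<le> g b") auto
    then show ?thesis using b by (auto simp: S_def)
  qed
  ultimately show ?thesis by (intro bexI[of _ S]) auto
qed

end

section \<open>Invariants of the Arrow protocol\<close>

definition nbr :: "nat list \<Rightarrow> nat list \<Rightarrow> bool" where
  "nbr a b \<longleftrightarrow> a \<noteq> [] \<and> b = butlast a \<or> b \<noteq> [] \<and> a = butlast b"

lemma nbr_commute: "nbr a b \<longleftrightarrow> nbr b a"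
  by (auto simp: nbr_def)

lemma butlast_neq: "z \<noteq> [] \<Longrightarrow> butlast z \<noteq> z"
  by (cases z rule: rev_cases) auto

lemma nbr_neq: "nbr a b \<Longrightarrow> a \<noteq> b"
  unfolding nbr_def using butlast_neq by metis

lemma edge_w_up: "z \<noteq> [] \<Longrightarrow> edge_w h z (butlast z) = 2 ^ (h - length z)"
  and edge_w_down: "z \<noteq> [] \<Longrightarrow> edge_w h (butlast z) z = 2 ^ (h - length z)"
  by (cases z rule: rev_cases; simp add: edge_w_def)+

lemma two_pow_butlast:
  assumes "z \<noteq> []" "length z \<le> h"
  shows "2 ^ (h - length (butlast z)) = 2 * (2::real) ^ (h - length z)"
proof -
  have "0 < length z" using assms(1) by simp
  then have "h - length (butlast z) = Suc (h - length z)"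
    unfolding length_butlast using assms(2) by linarith
  then show ?thesis by simp
qed

lemma two_pow_strict_prefix:
  assumes "strict_prefix y z" "length z \<le> h"
  shows "2 * (2::real) ^ (h - length z) \<le> 2 ^ (h - length y)"
proof -
  have "length y < length z" using assms by (simp add: prefix_length_less)
  then have "Suc (h - length z) \<le> h - length y" using assms by simp
  then have "(2::real) ^ Suc (h - length z) \<le> 2 ^ (h - length y)" by (rule power_increasing) simp
  then show ?thesis by simp
qed

lemma strict_prefix_butlast: "z \<noteq> [] \<Longrightarrow> strict_prefix (butlast z) z"
  using butlast_neq prefixeq_butlast by (auto simp: strict_prefix_def)

lemma prefix_butlastI: "strict_prefix w z \<Longrightarrow> prefix w (butlast z)"
  by (cases z rule: rev_cases) (auto simp: strict_prefix_def)

text \<open>By \<open>lnk_asym\<close> and \<open>msg_edge\<close>, an edge is pointed across by at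
  most one end, and by neither while it carries a message. The bound in \<open>msg_up\<close> is the
  sum \<open>2 ^ (h - length a) - 1\<close> of the edge lengths from a leaf up to \<open>a\<close>.
  \<open>lv u\<close> is the last visit to \<open>u\<close>: an upward link stems from a message
  sent by the parent when it was itself visited (\<open>lnk_up\<close>), or is initial; a downward
  link stems from a climbing message or, at a leaf, from a local request, and leads to a request
  issued not long before that visit (\<open>lnk_down\<close>).\<close>

locale arrow_state =
  fixes h n :: nat and req :: "nat \<Rightarrow> nat list \<times> real" and C :: cfg and lv :: "nat list \<Rightarrow> real"
  assumes lnk_nbr: "length u \<le> h \<Longrightarrow>
      lnk C u = u \<and> length u = h \<or> nbr u (lnk C u) \<and> length (lnk C u) \<le> h"
    and lnk_asym: "a \<noteq> b \<Longrightarrow> length a \<le> h \<Longrightarrow> lnk C a = b \<Longrightarrow> lnk C b \<noteq> a"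
    and msg_edge: "(i, a, b, s) \<in> msgs C \<Longrightarrow>
      nbr a b \<and> length a \<le> h \<and> length b \<le> h \<and> lnk C a \<noteq> b \<and> lnk C b \<noteq> a"
    and msg_time: "(i, a, b, s) \<in> msgs C \<Longrightarrow> s \<le> clock C"
    and msg_up: "(i, a, b, s) \<in> msgs C \<Longrightarrow> a \<noteq> [] \<Longrightarrow> b = butlast a \<Longrightarrow>
      i < n \<and> prefix a (fst (req i)) \<and> snd (req i) \<le> s \<and> s \<le> snd (req i) + 2 ^ (h - length a) - 1"
    and msg_down: "(i, a, b, s) \<in> msgs C \<Longrightarrow> b \<noteq> [] \<Longrightarrow> a = butlast b \<Longrightarrow> s \<le> lv a"
    and msg_unique: "(i, a, b, s) \<in> msgs C \<Longrightarrow> (i', a', b', s') \<in> msgs C \<Longrightarrow>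
      a' = a \<and> b' = b \<or> a' = b \<and> b' = a \<Longrightarrow> i' = i \<and> a' = a \<and> b' = b \<and> s' = s"
    and lv_clock: "lv u \<le> clock C"
    and lnk_up: "length u \<le> h \<Longrightarrow> u \<noteq> [] \<Longrightarrow> lnk C u = butlast u \<Longrightarrow>
      lv u - 2 ^ (h - length u) \<le> lv (butlast u)"
    and lnk_down: "length u \<le> h \<Longrightarrow> u = [] \<or> lnk C u \<noteq> butlast u \<Longrightarrow>
      \<exists>j<n. prefix (lnk C u) (fst (req j)) \<and> lv u - 2 ^ (h - length u) \<le> snd (req j) \<and> snd (req j) \<le> clock C"
begin

lemma lnk_internal:
  assumes "length u < h"
  shows "nbr u (lnk C u)" "length (lnk C u) \<le> h" "lnk C u \<noteq> u"
  using lnk_nbr[of u] assms nbr_neq by force+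

lemma lnk_leaf:
  assumes "length u = h" "lnk C u \<noteq> u"
  shows "u \<noteq> []" "lnk C u = butlast u"
proof -
  have n: "nbr u (lnk C u)" "length (lnk C u) \<le> h" using lnk_nbr[of u] assms by auto
  have "\<not> (lnk C u \<noteq> [] \<and> u = butlast (lnk C u))"
  proof
    assume *: "lnk C u \<noteq> [] \<and> u = butlast (lnk C u)"
    then have "length u < length (lnk C u)" by (metis length_butlast diff_less length_greater_0_conv zero_less_one)
    then show False using n assms by simp
  qed
  then show "u \<noteq> []" "lnk C u = butlast u" using n by (auto simp: nbr_def)
qed

lemma prefix_lnk_down:
  assumes "length u \<le> h" "u = [] \<or> lnk C u \<noteq> butlast u"
  shows "prefix u (lnk C u)"
proof (cases "lnk C u = u")
  case False
  then have "nbr u (lnk C u)" using lnk_nbr[OF assms(1)] by auto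
  then have "u = butlast (lnk C u)" using assms(2) by (auto simp: nbr_def)
  then show ?thesis by (metis prefixeq_butlast)
qed simp

end

section \<open>Events of the protocol and preservation of the invariants\<close>

lemma issue_step_simps [simp]:
  "clock (issue_step C i u x) = x"
  "issued (issue_step C i u x) = insert i (issued C)"
  "lnk (issue_step C i u x) = (lnk C)(u := u)"
  "msgs (issue_step C i u x) = (if lnk C u = u then msgs C else insert (i, u, lnk C u, x) (msgs C))"
  "res (issue_step C i u x) = (if lnk C u = u then (res C)(i := Some (lst C u, x)) else res C)"
  by (auto simp: issue_step_def)

lemma recv_step_simps [simp]:
  "clock (recv_step C (i, w, u, s) x) = x"
  "issued (recv_step C (i, w, u, s) x) = issued C"
  "lnk (recv_step C (i, w, u, s) x) = (lnk C)(u := w)"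
  "msgs (recv_step C (i, w, u, s) x) = (if lnk C u = u then msgs C - {(i, w, u, s)}
     else insert (i, u, lnk C u, x) (msgs C - {(i, w, u, s)}))"
  "res (recv_step C (i, w, u, s) x) = (if lnk C u = u then (res C)(i := Some (lst C u, x)) else res C)"
  by (auto simp: recv_step_def)

text \<open>The ghost component \<open>lv\<close> records when a node last received a message; it is 0 before that.\<close>

definition ghost_step :: "nat \<Rightarrow> nat \<Rightarrow> (nat \<Rightarrow> nat list \<times> real) \<Rightarrow> cfg \<Rightarrow> (nat list \<Rightarrow> real) \<Rightarrow>
    cfg \<Rightarrow> (nat list \<Rightarrow> real) \<Rightarrow> bool" where
  "ghost_step h n req C lv C' lv' \<longleftrightarrow>
    (\<exists>i. i \<in> {1..<n} \<and> i \<notin> issued C \<and> clock C \<le> snd (req i) \<and>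
       C' = issue_step C i (fst (req i)) (snd (req i)) \<and> lv' = lv) \<or>
    (\<exists>i w u s x. (i, w, u, s) \<in> msgs C \<and> clock C \<le> x \<and> s \<le> x \<and> x \<le> s + edge_w h w u \<and>
       C' = recv_step C (i, w, u, s) x \<and> lv' = lv(u := x))"

lemma ghost_step_cases [consumes 1, case_names issue recv]:
  assumes "ghost_step h n req C lv C' lv'"
  obtains i where "i \<in> {1..<n}" "i \<notin> issued C" "clock C \<le> snd (req i)"
      "C' = issue_step C i (fst (req i)) (snd (req i))" "lv' = lv"
  | i w u s x where "(i, w, u, s) \<in> msgs C" "clock C \<le> x" "s \<le> x" "x \<le> s + edge_w h w u"
      "C' = recv_step C (i, w, u, s) x" "lv' = lv(u := x)"
  using assms unfolding ghost_step_def by blast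

lemma ghost_step_clock: "ghost_step h n req C lv C' lv' \<Longrightarrow> clock C \<le> clock C'"
  by (erule ghost_step_cases) simp_all

lemma arrow_state_init:
  assumes n: "1 \<le> n" and leaf: "length (fst (req 0)) = h" and t0: "snd (req 0) = 0"
  shows "arrow_state h n req (init_cfg req) (\<lambda>_. 0)"
proof -
  let ?v = "fst (req 0)" and ?l = "init_link (fst (req 0))"
  have l: "?l u = (if u = ?v then u else if strict_prefix u ?v then take (Suc (length u)) ?v else butlast u)" for u
  proof -
    have "strict_prefix u ?v \<longleftrightarrow> take (length u) ?v = u \<and> length u < length ?v" if "u \<noteq> ?v"
    proof
      assume "strict_prefix u ?v"
      then show "take (length u) ?v = u \<and> length u < length ?v"
        by (auto simp: strict_prefix_def prefix_def prefix_length_less)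
    next
      assume "take (length u) ?v = u \<and> length u < length ?v"
      then show "strict_prefix u ?v" using that by (metis strict_prefix_def take_is_prefix)
    qed
    then show ?thesis by (simp add: init_link_def)
  qed
  have child: "take (Suc (length u)) ?v \<noteq> []" "butlast (take (Suc (length u)) ?v) = u"
      "length (take (Suc (length u)) ?v) \<le> h"
    if "strict_prefix u ?v" for u
  proof -
    have *: "length u < length ?v" "take (length u) ?v = u"
      using that by (auto simp: strict_prefix_def prefix_def prefix_length_less)
    then show "butlast (take (Suc (length u)) ?v) = u" by (simp add: butlast_take)
    show "take (Suc (length u)) ?v \<noteq> []" using * by (metis Suc_neq_Zero length_0_conv length_greater_0_conv less_zeroE take_eq_Nil)
    show "length (take (Suc (length u)) ?v) \<le> h" using leaf by simp
  qed
  have ne: "u \<noteq> []" if "u \<noteq> ?v" "\<not> strict_prefix u ?v" for u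
    using that by (auto simp: strict_prefix_def)
  show ?thesis
  proof unfold_locales
    fix u :: "nat list" assume u: "length u \<le> h"
    show "lnk (init_cfg req) u = u \<and> length u = h \<or>
        nbr u (lnk (init_cfg req) u) \<and> length (lnk (init_cfg req) u) \<le> h"
      using child[of u] ne[of u] u leaf unfolding init_cfg_def by (auto simp: l nbr_def)
  next
    fix a b :: "nat list" assume ab: "a \<noteq> b" "lnk (init_cfg req) a = b"
    then have b: "?l a = b" by (simp add: init_cfg_def)
    have "?l b \<noteq> a"
    proof
      assume a: "?l b = a"
      show False
      proof (cases "strict_prefix a ?v \<or> a = ?v")
        case True
        then have sa: "strict_prefix a ?v" "b = take (Suc (length a)) ?v" using b ab by (auto simp: l split: if_splits)
        then have bv: "prefix b ?v" by (simp add: take_is_prefix)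
        have "butlast b = a" "b \<noteq> []" using child[OF sa(1)] sa(2) by auto
        then have len: "length b = Suc (length a)" by (cases b rule: rev_cases) auto
        show False
        proof (cases "b = ?v")
          case True then show False using a ab by (simp add: l)
        next
          case False
          then have "strict_prefix b ?v" using bv by (simp add: strict_prefix_def)
          then have "a = take (Suc (length b)) ?v" "butlast a = b" using a child[of b] False by (auto simp: l)
          from this(2) have "length b = length a - 1" by (metis length_butlast)
          then show False using len by simp
        qed
      next
        case False
        then have ba: "b = butlast a" "a \<noteq> []" using b ne by (auto simp: l)
        have "b \<noteq> butlast a \<or> \<not> (strict_prefix b ?v) \<or> take (Suc (length b)) ?v \<noteq> a"
          using False by (metis strict_prefix_def take_is_prefix)
        then have "a = butlast b" using a ab ba by (auto simp: l split: if_splits)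
        then have "length a = length a - 1 - 1" using ba(1) by (metis length_butlast)
        then show False using ba by (cases a) auto
      qed
    qed
    then show "lnk (init_cfg req) b \<noteq> a" by (simp add: init_cfg_def)
  next
    fix u :: "nat list" assume u: "length u \<le> h" "u = [] \<or> lnk (init_cfg req) u \<noteq> butlast u"
    then have "u = ?v \<or> strict_prefix u ?v" using ne[of u] by (auto simp: init_cfg_def l split: if_splits)
    then have "prefix (?l u) ?v" by (auto simp: l take_is_prefix)
    then show "\<exists>j<n. prefix (lnk (init_cfg req) u) (fst (req j)) \<and> 0 - 2 ^ (h - length u) \<le> snd (req j) \<and>
        snd (req j) \<le> clock (init_cfg req)"
      using n t0 by (intro exI[of _ 0]) (simp add: init_cfg_def)
  qed (auto simp: init_cfg_def)
qed

lemma arrow_state_issue: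
  assumes st: "arrow_state h n req C lv" and i: "i < n" and leaf: "length (fst (req i)) = h"
    and cl: "clock C \<le> snd (req i)"
  shows "arrow_state h n req (issue_step C i (fst (req i)) (snd (req i))) lv"
proof -
  interpret arrow_state h n req C lv by (rule st)
  let ?v = "fst (req i)" and ?t = "snd (req i)" and ?C = "issue_step C i (fst (req i)) (snd (req i))"
  have par: "?v \<noteq> [] \<and> lnk C ?v = butlast ?v" if "lnk C ?v \<noteq> ?v" using lnk_leaf leaf that by blast
  have old: "(j, a, b, s) \<in> msgs C" if "(j, a, b, s) \<in> msgs ?C" "\<not> (lnk C ?v \<noteq> ?v \<and> j = i \<and> a = ?v \<and> b = butlast ?v \<and> s = ?t)"
    for j a b s using that par by (auto split: if_splits)
  show ?thesis
  proof unfold_locales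
    fix u :: "nat list" assume "length u \<le> h"
    then show "lnk ?C u = u \<and> length u = h \<or> nbr u (lnk ?C u) \<and> length (lnk ?C u) \<le> h"
      using lnk_nbr[of u] leaf by auto
  next
    fix a b :: "nat list" assume "a \<noteq> b" "length a \<le> h" "lnk ?C a = b"
    then show "lnk ?C b \<noteq> a" using lnk_asym[of a b] by (auto split: if_splits)
  next
    fix j a b s assume m: "(j, a, b, s) \<in> msgs ?C"
    show "nbr a b \<and> length a \<le> h \<and> length b \<le> h \<and> lnk ?C a \<noteq> b \<and> lnk ?C b \<noteq> a"
    proof (cases "(j, a, b, s) \<in> msgs C")
      case True
      then show ?thesis using msg_edge[OF True] nbr_neq[of a b] by auto
    next
      case False
      then have *: "lnk C ?v \<noteq> ?v" "a = ?v" "b = butlast ?v" using old[OF m] by blast+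
      then have p: "?v \<noteq> []" "lnk C ?v = butlast ?v" using par by auto
      have "lnk C (butlast ?v) \<noteq> ?v" using lnk_asym[of ?v "butlast ?v"] p butlast_neq[OF p(1)] leaf by auto
      then show ?thesis using * p leaf butlast_neq[OF p(1)] by (auto simp: nbr_def)
    qed
    show "s \<le> clock ?C" using old[OF m] msg_time[of j a b s] cl by (cases "(j, a, b, s) \<in> msgs C") auto
    show "j < n \<and> prefix a (fst (req j)) \<and> snd (req j) \<le> s \<and> s \<le> snd (req j) + 2 ^ (h - length a) - 1"
      if "a \<noteq> []" "b = butlast a"
    proof (cases "(j, a, b, s) \<in> msgs C")
      case True then show ?thesis using msg_up that by blast
    next
      case False
      then have "j = i" "a = ?v" "s = ?t" using old[OF m] by blast+
      then show ?thesis using i leaf by simp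
    qed
    show "s \<le> lv a" if "b \<noteq> []" "a = butlast b"
    proof (cases "(j, a, b, s) \<in> msgs C")
      case True then show ?thesis using msg_down that by blast
    next
      case False
      then have "a = ?v" "b = butlast ?v" using old[OF m] by blast+
      then have "length b = length b - 1 - 1" using that by (metis length_butlast)
      then show ?thesis using that(1) by (cases b) auto
    qed
  next
    fix j a b s j' a' b' s'
    assume m: "(j, a, b, s) \<in> msgs ?C" and m': "(j', a', b', s') \<in> msgs ?C"
      and e: "a' = a \<and> b' = b \<or> a' = b \<and> b' = a"
    \<comment> \<open>The edge taken by the new message was pointed across before, so it carried
      nothing in either direction.\<close>
    have new: False if "(k, c, d, r) \<in> msgs C" "lnk C ?v \<noteq> ?v"
      "c = ?v \<and> d = butlast ?v \<or> c = butlast ?v \<and> d = ?v" for k c d r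
      using msg_edge[OF that(1)] par[OF that(2)] that(3) by auto
    show "j' = j \<and> a' = a \<and> b' = b \<and> s' = s"
    proof (cases "(j, a, b, s) \<in> msgs C"; cases "(j', a', b', s') \<in> msgs C")
      assume "(j, a, b, s) \<in> msgs C" "(j', a', b', s') \<in> msgs C"
      then show ?thesis using msg_unique e by blast
    next
      assume "(j, a, b, s) \<in> msgs C" "(j', a', b', s') \<notin> msgs C"
      then show ?thesis using old[OF m'] new e by blast
    next
      assume "(j, a, b, s) \<notin> msgs C" "(j', a', b', s') \<in> msgs C"
      then show ?thesis using old[OF m] new e by blast
    next
      assume "(j, a, b, s) \<notin> msgs C" "(j', a', b', s') \<notin> msgs C"
      then have "j = i \<and> a = ?v \<and> b = butlast ?v \<and> s = ?t" "j' = i \<and> a' = ?v \<and> b' = butlast ?v \<and> s' = ?t"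
        using old[OF m] old[OF m'] by blast+
      then show ?thesis by simp
    qed
  next
    fix u :: "nat list" show "lv u \<le> clock ?C" using lv_clock[of u] cl by simp
  next
    fix u :: "nat list" assume u: "length u \<le> h" "u \<noteq> []" "lnk ?C u = butlast u"
    then have "u \<noteq> ?v" using butlast_neq[OF u(2)] by (metis fun_upd_same issue_step_simps(3))
    then have "lnk C u = butlast u" using u(3) by (metis fun_upd_other issue_step_simps(3))
    then show "lv u - 2 ^ (h - length u) \<le> lv (butlast u)" using lnk_up u by blast
  next
    fix u :: "nat list" assume u: "length u \<le> h" "u = [] \<or> lnk ?C u \<noteq> butlast u"
    show "\<exists>j<n. prefix (lnk ?C u) (fst (req j)) \<and> lv u - 2 ^ (h - length u) \<le> snd (req j) \<and> snd (req j) \<le> clock ?C"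
    proof (cases "u = ?v")
      case True
      have "lv u - 2 ^ (h - length u) \<le> ?t" using lv_clock[of u] cl
        by (smt (verit) zero_le_power)
      then show ?thesis using True i by (intro exI[of _ i]) simp
    next
      case False
      then obtain j where "j < n" "prefix (lnk C u) (fst (req j))" "lv u - 2 ^ (h - length u) \<le> snd (req j)" "snd (req j) \<le> clock C"
        using lnk_down[of u] u by auto
      then show ?thesis using False cl by (intro exI[of _ j]) simp
    qed
  qed
qed

text \<open>The two edges involved swap roles: the edge of arrival becomes free and is pointed back
  across, while the edge that was pointed across takes the forwarded message, if there is
  one.\<close>

lemma arrow_state_recv:
  assumes st: "arrow_state h n req C lv" and m: "(i, w, u, s) \<in> msgs C"
    and cl: "clock C \<le> x" and x: "x \<le> s + edge_w h w u"
  shows "arrow_state h n req (recv_step C (i, w, u, s) x) (lv(u := x))"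
proof -
  interpret arrow_state h n req C lv by (rule st)
  let ?C = "recv_step C (i, w, u, s) x" and ?lv = "lv(u := x)"
  have e: "nbr w u" "length w \<le> h" "length u \<le> h" "lnk C w \<noteq> u" "lnk C u \<noteq> w" using msg_edge[OF m] by auto
  have sx: "s \<le> x" using msg_time[OF m] cl by simp
  \<comment> \<open>Climbing the edge above \<open>w\<close> adds \<open>2 ^ (h - length w)\<close>
    to the delay, and \<open>2 ^ (h - length u)\<close> is twice that amount.\<close>
  have up: "i < n" "prefix w (fst (req i))" "snd (req i) \<le> s" "x \<le> snd (req i) + 2 ^ (h - length u) - 1"
    if "w \<noteq> []" "u = butlast w"
  proof -
    show "i < n" "prefix w (fst (req i))" "snd (req i) \<le> s" using msg_up[OF m that] by auto
    show "x \<le> snd (req i) + 2 ^ (h - length u) - 1"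
      using msg_up[OF m that] x two_pow_butlast[OF that(1) e(2)] edge_w_up[OF that(1), of h] that by simp
  qed
  have down: "s \<le> lv w" "x \<le> lv w + 2 ^ (h - length u)" if "u \<noteq> []" "w = butlast u"
    using msg_down[OF m that] x edge_w_down[OF that(1), of h] that by auto
  have lnk_u: "nbr u (lnk C u)" "length (lnk C u) \<le> h" if "lnk C u \<noteq> u" using lnk_nbr[OF e(3)] that by auto
  have old: "(j, a, b, r) \<in> msgs C \<and> (j, a, b, r) \<noteq> (i, w, u, s)"
    if "(j, a, b, r) \<in> msgs ?C" "\<not> (lnk C u \<noteq> u \<and> j = i \<and> a = u \<and> b = lnk C u \<and> r = x)" for j a b r
    using that by (auto split: if_splits)
  show ?thesis
  proof unfold_locales
    fix y :: "nat list" assume "length y \<le> h"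
    then show "lnk ?C y = y \<and> length y = h \<or> nbr y (lnk ?C y) \<and> length (lnk ?C y) \<le> h"
      using lnk_nbr[of y] e nbr_commute by auto
  next
    fix a b :: "nat list" assume ab: "a \<noteq> b" "length a \<le> h" "lnk ?C a = b"
    show "lnk ?C b \<noteq> a"
    proof (cases "a = u")
      case True
      then show ?thesis using ab e by auto
    next
      case False
      then show ?thesis using lnk_asym[of a b] ab e by auto
    qed
  next
    fix j a b r assume mm: "(j, a, b, r) \<in> msgs ?C"
    show "nbr a b \<and> length a \<le> h \<and> length b \<le> h \<and> lnk ?C a \<noteq> b \<and> lnk ?C b \<noteq> a"
    proof (cases "lnk C u \<noteq> u \<and> j = i \<and> a = u \<and> b = lnk C u \<and> r = x")
      case True
      then have "lnk C b \<noteq> a" using lnk_asym[of a b] e by auto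
      then show ?thesis using True lnk_u e by auto
    next
      case False
      then have o: "(j, a, b, r) \<in> msgs C" "(j, a, b, r) \<noteq> (i, w, u, s)" using old[OF mm] by auto
      \<comment> \<open>An edge carries only one message, so no remaining message uses the edge
        whose link has just been reset.\<close>
      have "\<not> (a = u \<and> b = w \<or> a = w \<and> b = u)" using msg_unique[OF m o(1)] o(2) by blast
      then show ?thesis using msg_edge[OF o(1)] by (metis fun_upd_apply recv_step_simps(3))
    qed
    show "r \<le> clock ?C" using old[OF mm] msg_time[of j a b r] cl
      by (cases "lnk C u \<noteq> u \<and> j = i \<and> a = u \<and> b = lnk C u \<and> r = x") auto
    show "j < n \<and> prefix a (fst (req j)) \<and> snd (req j) \<le> r \<and> r \<le> snd (req j) + 2 ^ (h - length a) - 1"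
      if ab: "a \<noteq> []" "b = butlast a"
    proof (cases "lnk C u \<noteq> u \<and> j = i \<and> a = u \<and> b = lnk C u \<and> r = x")
      case True
      \<comment> \<open>The link of \<open>u\<close> never points along the edge of arrival, so a
        message forwarded to the parent came from a child.\<close>
      then have "w \<noteq> []" "u = butlast w" using e ab by (auto simp: nbr_def)
      moreover have "prefix u w" using calculation prefixeq_butlast by metis
      ultimately show ?thesis using True up sx by (auto intro: prefix_order.trans)
    next
      case False
      then show ?thesis using old[OF mm] msg_up[of j a b r] ab by blast
    qed
    show "r \<le> ?lv a" if "b \<noteq> []" "a = butlast b"
    proof (cases "lnk C u \<noteq> u \<and> j = i \<and> a = u \<and> b = lnk C u \<and> r = x")
      case True then show ?thesis by simp
    next
      case False
      then have "(j, a, b, r) \<in> msgs C" using old[OF mm] by blast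
      then show ?thesis using msg_down msg_time[of j a b r] that cl by fastforce
    qed
  next
    fix j a b r j' a' b' r'
    assume m1: "(j, a, b, r) \<in> msgs ?C" and m2: "(j', a', b', r') \<in> msgs ?C"
      and ee: "a' = a \<and> b' = b \<or> a' = b \<and> b' = a"
    have new: False if "(k, c, d, q) \<in> msgs C" "c = u \<and> d = lnk C u \<or> c = lnk C u \<and> d = u" for k c d q
      using msg_edge[OF that(1)] that(2) by auto
    show "j' = j \<and> a' = a \<and> b' = b \<and> r' = r"
    proof (cases "lnk C u \<noteq> u \<and> j = i \<and> a = u \<and> b = lnk C u \<and> r = x";
        cases "lnk C u \<noteq> u \<and> j' = i \<and> a' = u \<and> b' = lnk C u \<and> r' = x")
      assume "\<not> (lnk C u \<noteq> u \<and> j = i \<and> a = u \<and> b = lnk C u \<and> r = x)"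
        "\<not> (lnk C u \<noteq> u \<and> j' = i \<and> a' = u \<and> b' = lnk C u \<and> r' = x)"
      then show ?thesis using old[OF m1] old[OF m2] msg_unique ee by blast
    next
      assume *: "lnk C u \<noteq> u \<and> j = i \<and> a = u \<and> b = lnk C u \<and> r = x"
        and "\<not> (lnk C u \<noteq> u \<and> j' = i \<and> a' = u \<and> b' = lnk C u \<and> r' = x)"
      then have "(j', a', b', r') \<in> msgs C" using old[OF m2] by blast
      then show ?thesis using new[of j' a' b' r'] * ee by auto
    next
      assume "\<not> (lnk C u \<noteq> u \<and> j = i \<and> a = u \<and> b = lnk C u \<and> r = x)"
        and *: "lnk C u \<noteq> u \<and> j' = i \<and> a' = u \<and> b' = lnk C u \<and> r' = x"
      then have "(j, a, b, r) \<in> msgs C" using old[OF m1] by blast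
      then show ?thesis using new[of j a b r] * ee by auto
    qed simp
  next
    fix y :: "nat list" show "?lv y \<le> clock ?C" using lv_clock[of y] cl by simp
  next
    fix y :: "nat list" assume y: "length y \<le> h" "y \<noteq> []" "lnk ?C y = butlast y"
    show "?lv y - 2 ^ (h - length y) \<le> ?lv (butlast y)"
    proof (cases "y = u")
      case True
      then show ?thesis using down y butlast_neq[of y] by auto
    next
      case False
      then have "lv y - 2 ^ (h - length y) \<le> lv (butlast y)" using lnk_up y by auto
      then show ?thesis using False lv_clock[of "butlast y"] cl by auto
    qed
  next
    fix y :: "nat list" assume y: "length y \<le> h" "y = [] \<or> lnk ?C y \<noteq> butlast y"
    show "\<exists>j<n. prefix (lnk ?C y) (fst (req j)) \<and> ?lv y - 2 ^ (h - length y) \<le> snd (req j) \<and> snd (req j) \<le> clock ?C"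
    proof (cases "y = u")
      case True
      then have "w \<noteq> []" "u = butlast w" using y e by (auto simp: nbr_def)
      then show ?thesis using up True sx by (intro exI[of _ i]) auto
    next
      case False
      then obtain j where "j < n" "prefix (lnk C y) (fst (req j))" "lv y - 2 ^ (h - length y) \<le> snd (req j)" "snd (req j) \<le> clock C"
        using lnk_down[of y] y by auto
      then show ?thesis using False cl by (intro exI[of _ j]) simp
    qed
  qed
qed

text \<open>The difference of powers is the total length of the edges from \<open>z\<close> up to
  \<open>w\<close>, so \<open>D\<close> bounds the arrival time at \<open>w\<close> if the message
  climbs the whole way.\<close>

definition heading :: "nat \<Rightarrow> cfg \<Rightarrow> nat list \<Rightarrow> real \<Rightarrow> bool" where
  "heading h C w D \<longleftrightarrow> (\<exists>i z s. (i, z, butlast z, s) \<in> msgs C \<and> strict_prefix w z \<and>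
     (\<forall>y. strict_prefix w y \<and> strict_prefix y z \<longrightarrow> lnk C y = butlast y) \<and>
     s + 2 ^ (h - length w) - 2 ^ (h - length z) \<le> D)"

text \<open>Some message climbing towards \<open>w\<close> along upward links arrives there by time \<open>D\<close>: a message
  joining the path ahead of it starts higher up, and does so before the first one would be there.\<close>

lemma heading_step:
  assumes st: "arrow_state h n req C lv" and step: "ghost_step h n req C lv C' lv'"
    and dl: "\<And>i a b s. (i, a, b, s) \<in> msgs C \<Longrightarrow> clock C' \<le> s + edge_w h a b"
    and leaf: "\<And>i. i < n \<Longrightarrow> length (fst (req i)) = h"
    and head: "heading h C w D"
  shows "heading h C' w D \<or> lv' w = clock C'"
proof -
  interpret arrow_state h n req C lv by (rule st)
  from head obtain i z s where m: "(i, z, butlast z, s) \<in> msgs C" and wz: "strict_prefix w z"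
    and path: "\<And>y. strict_prefix w y \<Longrightarrow> strict_prefix y z \<Longrightarrow> lnk C y = butlast y"
    and D: "s + 2 ^ (h - length w) - 2 ^ (h - length z) \<le> D" unfolding heading_def by blast
  have z: "z \<noteq> []" "length z \<le> h" using wz msg_edge[OF m] by auto
  have dz: "clock C' \<le> s + 2 ^ (h - length z)" using dl[OF m] edge_w_up[OF z(1)] by simp
  show ?thesis using step
  proof (cases rule: ghost_step_cases)
    case (issue j)
    have "lnk C' y = butlast y" if "strict_prefix w y" "strict_prefix y z" for y
    proof -
      have "y \<noteq> fst (req j)" using prefix_length_less[OF that(2)] z leaf[of j] issue(1) by auto
      then show ?thesis using path[OF that] issue by simp
    qed
    moreover have "(i, z, butlast z, s) \<in> msgs C'" using m issue by simp
    ultimately show ?thesis unfolding heading_def using wz D by blast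
  next
    case (recv j a u r x)
    show ?thesis
    proof (cases "u = w")
      case True then show ?thesis using recv by simp
    next
      case False
      show ?thesis
      proof (cases "strict_prefix w u \<and> strict_prefix u z")
        case True
        \<comment> \<open>This covers both the arrival of the witness at its own parent and another
          message cutting in ahead of it. The message just forwarded from \<open>u\<close> becomes
          the new witness.\<close>
        then have u: "u \<noteq> []" "lnk C u = butlast u" using path by auto
        have "(j, u, butlast u, x) \<in> msgs C'" using recv u butlast_neq[OF u(1)] by simp
        moreover have "lnk C' y = butlast y" if "strict_prefix w y" "strict_prefix y u" for y
          using that path[of y] True recv by (auto intro: prefix_order.less_trans)
        \<comment> \<open>By its deadline \<open>x\<close> is at most
          \<open>s + 2 ^ (h - length z)\<close>, and subtracting the power for \<open>u\<close>, at
          least twice that for \<open>z\<close>, compensates for this.\<close>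
        moreover have "x + 2 ^ (h - length w) - 2 ^ (h - length u) \<le> D"
          using two_pow_strict_prefix[of u z h] True z D dz recv by simp
        ultimately show ?thesis unfolding heading_def using True by blast
      next
        case nb: False
        have "(j, a, u, r) \<noteq> (i, z, butlast z, s)"
        proof
          assume "(j, a, u, r) = (i, z, butlast z, s)"
          then have "u = butlast z" by simp
          then show False using nb False prefix_butlastI[OF wz] strict_prefix_butlast[OF z(1)]
            by (auto simp: strict_prefix_def)
        qed
        then have "(i, z, butlast z, s) \<in> msgs C'" using m recv by auto
        moreover have "lnk C' y = butlast y" if "strict_prefix w y" "strict_prefix y z" for y
          using that path[of y] nb recv by auto
        ultimately show ?thesis unfolding heading_def using wz D by blast
      qed
    qed
  qed
qed

section \<open>The accumulated cost of Arrow\<close>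

definition pending_cost :: "(nat \<Rightarrow> nat list \<times> real) \<Rightarrow> cfg \<Rightarrow> real \<Rightarrow> real" where
  "pending_cost req C x = (\<Sum>i\<in>issued C. (case res C i of None \<Rightarrow> x | Some (p, y) \<Rightarrow> y) - snd (req i))"

text \<open>Messages in transit correspond one to one to issued requests not yet queued, so their
  number is the rate at which the accumulated cost grows.\<close>

definition msgs_match :: "nat \<Rightarrow> cfg \<Rightarrow> bool" where
  "msgs_match n C \<longleftrightarrow> issued C \<subseteq> {1..<n} \<and> (\<forall>i. i \<notin> issued C \<longrightarrow> res C i = None) \<and>
     inj_on fst (msgs C) \<and> fst ` msgs C = {i\<in>issued C. res C i = None}"

lemma msgs_match_finite: "msgs_match n C \<Longrightarrow> finite (issued C)"
  unfolding msgs_match_def using finite_subset by blast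

text \<open>A request that is issued or queued at the current time contributes the same just before
  and just after the event.\<close>

lemma msgs_match_step:
  assumes mm: "msgs_match n C" and step: "ghost_step h n req C lv C' lv'"
  shows "msgs_match n C'" "pending_cost req C' (clock C') = pending_cost req C (clock C')"
proof -
  have fin: "finite (issued C)" using mm by (rule msgs_match_finite)
  have m: "issued C \<subseteq> {1..<n}" "\<And>i. i \<notin> issued C \<Longrightarrow> res C i = None" "inj_on fst (msgs C)"
    "fst ` msgs C = {i\<in>issued C. res C i = None}" using mm by (auto simp: msgs_match_def)
  have "msgs_match n C' \<and> pending_cost req C' (clock C') = pending_cost req C (clock C')" using step
  proof (cases rule: ghost_step_cases)
    case (issue i)
    have new: "i \<notin> fst ` msgs C" using issue m by auto
    have "pending_cost req C' (clock C') = pending_cost req C (clock C')"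
    proof -
      have "pending_cost req C' (clock C') = (\<Sum>j\<in>issued C. (case res C' j of None \<Rightarrow> snd (req i) | Some (p, y) \<Rightarrow> y) - snd (req j))"
        using issue fin m(2)[of i] by (simp add: pending_cost_def)
      also have "\<dots> = pending_cost req C (clock C')" unfolding pending_cost_def
        using issue by (intro sum.cong) (auto split: option.split)
      finally show ?thesis .
    qed
    moreover have "msgs_match n C'"
      unfolding msgs_match_def
    proof (intro conjI)
      show "issued C' \<subseteq> {1..<n}" using issue m by auto
      show "\<forall>j. j \<notin> issued C' \<longrightarrow> res C' j = None" using issue m by auto
      show "inj_on fst (msgs C')" using issue m(3) new by (auto simp: inj_on_insert)
      show "fst ` msgs C' = {j\<in>issued C'. res C' j = None}"
        using issue m(2)[of i] m(4) by (auto simp: set_eq_iff)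
    qed
    ultimately show ?thesis by simp
  next
    case (recv i w u s x)
    have i: "i \<in> issued C" "res C i = None" using m(4) recv(1) by force+
    have rest: "fst ` (msgs C - {(i, w, u, s)}) = fst ` msgs C - {i}"
      using inj_on_image_set_diff[OF m(3), of "msgs C" "{(i, w, u, s)}"] recv(1) by auto
    have "pending_cost req C' (clock C') = pending_cost req C (clock C')"
      unfolding pending_cost_def using recv i by (intro sum.cong) auto
    moreover have "msgs_match n C'"
      unfolding msgs_match_def
    proof (intro conjI)
      show "issued C' \<subseteq> {1..<n}" using recv m by auto
      show "\<forall>j. j \<notin> issued C' \<longrightarrow> res C' j = None" using recv m i by auto
      have sub: "inj_on fst (msgs C - {(i, w, u, s)})" using m(3) by (rule inj_on_subset) auto
      then show "inj_on fst (msgs C')" using recv rest by (auto simp: inj_on_insert)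
      show "fst ` msgs C' = {j\<in>issued C'. res C' j = None}"
        using recv i m(4) rest by (auto simp: image_insert)
    qed
    ultimately show ?thesis by simp
  qed
  then show "msgs_match n C'" "pending_cost req C' (clock C') = pending_cost req C (clock C')" by auto
qed

lemma pending_cost_advance:
  assumes "msgs_match n C"
  shows "pending_cost req C y = pending_cost req C x + (y - x) * card (msgs C)"
proof -
  have fin: "finite (issued C)" using assms by (rule msgs_match_finite)
  have "card (msgs C) = card {i\<in>issued C. res C i = None}"
    using assms card_image unfolding msgs_match_def by metis
  then have "(y - x) * card (msgs C) = (\<Sum>i\<in>{i\<in>issued C. res C i = None}. y - x)" by simp
  also have "\<dots> = (\<Sum>i\<in>issued C. if res C i = None then y - x else 0)" by (rule sum.inter_filter[OF fin])
  finally have "pending_cost req C x + (y - x) * card (msgs C)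
    = (\<Sum>i\<in>issued C. ((case res C i of None \<Rightarrow> x | Some (p, y) \<Rightarrow> y) - snd (req i)) + (if res C i = None then y - x else 0))"
    by (simp add: pending_cost_def sum.distrib)
  also have "\<dots> = pending_cost req C y" unfolding pending_cost_def
    by (intro sum.cong) (auto split: option.splits)
  finally show ?thesis by simp
qed

section \<open>Executions as finite traces\<close>

locale execution =
  fixes h n :: nat and req :: "nat \<Rightarrow> nat list \<times> real"
    and f :: "nat \<Rightarrow> cfg" and lv :: "nat \<Rightarrow> nat list \<Rightarrow> real" and L :: nat
  assumes n_pos: "1 \<le> n" and leaf: "i < n \<Longrightarrow> length (fst (req i)) = h"
    and t0: "snd (req 0) = 0"
    and init: "f 0 = init_cfg req" "lv 0 = (\<lambda>_. 0)"
    and steps: "k < L \<Longrightarrow> ghost_step h n req (f k) (lv k) (f (Suc k)) (lv (Suc k))"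
    and final: "msgs (f L) = {}"
begin

text \<open>Half-open lifetimes make the configuration at time \<open>x\<close> unique; simultaneous
  events leave empty lifetimes in between.\<close>

definition at_time :: "nat \<Rightarrow> real \<Rightarrow> bool" where
  "at_time k x \<longleftrightarrow> k < L \<and> clock (f k) \<le> x \<and> x < clock (f (Suc k))"

lemma state: "k \<le> L \<Longrightarrow> arrow_state h n req (f k) (lv k)"
proof (induction k)
  case 0
  show ?case unfolding init by (rule arrow_state_init) (use n_pos leaf[of 0] t0 in auto)
next
  case (Suc k)
  then have st: "arrow_state h n req (f k) (lv k)" and "k < L" by auto
  from steps[OF this(2)] show ?case
  proof (cases rule: ghost_step_cases)
    case (issue i)
    then show ?thesis using arrow_state_issue[OF st, of i] leaf[of i] by simp
  next
    case (recv i w u s x)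
    show ?thesis unfolding recv(5,6) by (rule arrow_state_recv[OF st recv(1,2,4)])
  qed
qed

lemma clock_mono: "k \<le> l \<Longrightarrow> l \<le> L \<Longrightarrow> clock (f k) \<le> clock (f l)"
proof (induction l)
  case (Suc l)
  then show ?case using ghost_step_clock[OF steps[of l]] by (cases "k = Suc l") auto
qed simp

lemma msg_persists:
  assumes "k < L" "m \<in> msgs (f k)"
  shows "m \<in> msgs (f (Suc k)) \<or> (case m of (i, a, b, s) \<Rightarrow> clock (f (Suc k)) \<le> s + edge_w h a b \<and> lv (Suc k) b = clock (f (Suc k)))"
  using steps[OF assms(1)] assms(2) by (cases rule: ghost_step_cases) (auto split: if_splits)

text \<open>Backwards from the end, where nothing is in transit: a message present now is received
  later, within its delay bound, and the clock never decreases.\<close>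

lemma deadline_weak: "k \<le> L \<Longrightarrow> (i, a, b, s) \<in> msgs (f k) \<Longrightarrow> clock (f k) \<le> s + edge_w h a b"
proof (induction k rule: inc_induct)
  case base then show ?case using final by simp
next
  case (step k)
  have "clock (f k) \<le> clock (f (Suc k))" using clock_mono step.hyps by simp
  then show ?case using msg_persists[OF _ step.prems] step by auto
qed

lemma deadline:
  assumes "k < L" "(i, a, b, s) \<in> msgs (f k)"
  shows "clock (f (Suc k)) \<le> s + edge_w h a b"
  using msg_persists[OF assms] deadline_weak[of "Suc k" i a b s] assms by auto

lemma lv_mono: "k \<le> l \<Longrightarrow> l \<le> L \<Longrightarrow> lv k u \<le> lv l u"
proof (induction l)
  case (Suc l)
  show ?case
  proof (cases "k = Suc l")
    case False
    then have IH: "lv k u \<le> lv l u" and l: "l < L" using Suc by auto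
    interpret arrow_state h n req "f l" "lv l" using state l by simp
    have "lv l u \<le> lv (Suc l) u" using steps[OF l]
      by (cases rule: ghost_step_cases) (use lv_clock[of u] in auto)
    then show ?thesis using IH by simp
  qed simp
qed simp

text \<open>A message leaves transit only by visiting its receiver, at the next event or later,
  which is strictly after any time at which configuration \<open>k\<close> was current.\<close>

lemma msg_or_visited:
  assumes "k \<le> l" "l \<le> L" "(i, a, b, s) \<in> msgs (f k)"
  shows "(i, a, b, s) \<in> msgs (f l) \<or> clock (f (Suc k)) \<le> lv l b"
  using assms
proof (induction l rule: dec_induct)
  case (step l)
  then have l: "l < L" by simp
  show ?case
  proof (cases "(i, a, b, s) \<in> msgs (f l)")
    case True
    from msg_persists[OF l True] show ?thesis
      using clock_mono[of "Suc k" "Suc l"] step l by auto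
  next
    case False
    then show ?thesis using step lv_mono[of l "Suc l" b] by auto
  qed
qed simp

lemma heading_or_visited:
  assumes "k \<le> l" "l \<le> L" "heading h (f k) w D"
  shows "heading h (f l) w D \<or> clock (f (Suc k)) \<le> lv l w"
  using assms
proof (induction l rule: dec_induct)
  case (step l)
  then have l: "l < L" by simp
  show ?case
  proof (cases "heading h (f l) w D")
    case True
    have "heading h (f (Suc l)) w D \<or> lv (Suc l) w = clock (f (Suc l))"
      using state[of l] l by (intro heading_step[OF _ steps[OF l] _ leaf True]) (auto intro: deadline)
    then show ?thesis using clock_mono[of "Suc k" "Suc l"] step l by auto
  next
    case False
    then show ?thesis using step lv_mono[of l "Suc l" w] by auto
  qed
qed simp

definition used_down :: "nat list \<Rightarrow> real \<Rightarrow> bool" where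
  "used_down z x \<longleftrightarrow> z \<noteq> [] \<and> (\<exists>k i s. at_time k x \<and> (i, butlast z, z, s) \<in> msgs (f k))"

text \<open>For such \<open>z\<close>, \<open>theta h z / 2\<close> equals
  \<open>2 ^ (h - length (butlast z))\<close>, which exceeds the length of any climb to the
  parent.\<close>

definition used_up :: "nat list \<Rightarrow> real \<Rightarrow> bool" where
  "used_up z x \<longleftrightarrow> z \<noteq> [] \<and> length z \<le> h \<and> (\<exists>k. at_time k x \<and> lnk (f k) (butlast z) = z \<and>
     heading h (f k) (butlast z) (x + theta h z / 2))"

lemma at_time_le: "at_time k x \<Longrightarrow> at_time l y \<Longrightarrow> x \<le> y \<Longrightarrow> k \<le> l"
  using clock_mono[of "Suc l" k] unfolding at_time_def by (meson Suc_leI less_imp_le_nat not_le order_le_less_trans order_less_le_trans)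

text \<open>At time \<open>y\<close> the edge is busy, so \<open>z\<close> does not link upwards.
  Had \<open>z\<close> been visited after \<open>x\<close>, \<open>lnk_down\<close> would give a
  recent request below it. So the message seen at \<open>x\<close> is still in transit at
  \<open>y\<close>, and its deadline bounds \<open>y\<close>.\<close>

lemma used_down_gap:
  assumes "used_down z x" "used_down z y" "x \<le> y"
    and no: "\<And>j. j < n \<Longrightarrow> prefix z (fst (req j)) \<Longrightarrow> x - theta h z < snd (req j) \<Longrightarrow> snd (req j) \<le> y \<Longrightarrow> False"
  shows "y \<le> x + theta h z / 2"
proof -
  from assms(1) obtain k i s where k: "at_time k x" "(i, butlast z, z, s) \<in> msgs (f k)" and z: "z \<noteq> []"
    by (auto simp: used_down_def)
  from assms(2) obtain l i' s' where l: "at_time l y" "(i', butlast z, z, s') \<in> msgs (f l)"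
    by (auto simp: used_down_def)
  have kl: "k \<le> l" "l < L" "k < L" using at_time_le[OF k(1) l(1) assms(3)] l k by (auto simp: at_time_def)
  interpret K: arrow_state h n req "f k" "lv k" using state kl by simp
  interpret I: arrow_state h n req "f l" "lv l" using state kl by simp
  have sk: "s \<le> x" using K.msg_time[OF k(2)] k(1) by (simp add: at_time_def)
  have ez: "lnk (f l) z \<noteq> butlast z" "length z \<le> h" using I.msg_edge[OF l(2)] by auto
  have "\<not> clock (f (Suc k)) \<le> lv l z"
  proof
    assume "clock (f (Suc k)) \<le> lv l z"
    then have x: "x < lv l z" using k(1) by (simp add: at_time_def)
    obtain j where j: "j < n" "prefix (lnk (f l) z) (fst (req j))" "lv l z - 2 ^ (h - length z) \<le> snd (req j)"
      "snd (req j) \<le> clock (f l)" using I.lnk_down[OF ez(2)] ez(1) by blast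
    have "prefix z (fst (req j))" using I.prefix_lnk_down[OF ez(2)] ez(1) j(2) prefix_order.trans by blast
    moreover have "x - theta h z < snd (req j)"
    proof -
      have "0 < (2::real) ^ (h - length z)" by simp
      then show ?thesis using j(3) x unfolding theta_def by linarith
    qed
    moreover have "snd (req j) \<le> y" using j l(1) by (simp add: at_time_def)
    ultimately show False using no j(1) by blast
  qed
  then have "(i, butlast z, z, s) \<in> msgs (f l)" using msg_or_visited[OF kl(1) _ k(2)] kl by auto
  then have "y < s + edge_w h (butlast z) z" using deadline[OF kl(2)] l(1) by (force simp: at_time_def)
  then have "y < x + 2 ^ (h - length z)" using edge_w_down[OF z, of h] sk by simp
  moreover have "0 < (2::real) ^ (h - length z)" by simp
  ultimately show ?thesis unfolding theta_def by linarith
qed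

text \<open>At time \<open>y\<close> the parent links to \<open>z\<close>. Had the parent been
  visited after \<open>x\<close>, \<open>lnk_down\<close> would give a recent request below
  \<open>z\<close>. So the climb seen at \<open>x\<close> is still unfinished at \<open>y\<close>,
  under the same arrival bound.\<close>

lemma used_up_gap:
  assumes "used_up z x" "used_up z y" "x \<le> y"
    and no: "\<And>j. j < n \<Longrightarrow> prefix z (fst (req j)) \<Longrightarrow> x - theta h z < snd (req j) \<Longrightarrow> snd (req j) \<le> y \<Longrightarrow> False"
  shows "y \<le> x + theta h z / 2"
proof -
  let ?w = "butlast z"
  from assms(1) obtain k where k: "at_time k x" "heading h (f k) ?w (x + theta h z / 2)"
    and z: "z \<noteq> []" "length z \<le> h" by (auto simp: used_up_def)
  from assms(2) obtain l where l: "at_time l y" "lnk (f l) ?w = z" by (auto simp: used_up_def)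
  have kl: "k \<le> l" "l < L" "k < L" using at_time_le[OF k(1) l(1) assms(3)] l k by (auto simp: at_time_def)
  interpret I: arrow_state h n req "f l" "lv l" using state kl by simp
  have w2: "2 ^ (h - length ?w) = 2 * (2::real) ^ (h - length z)" using two_pow_butlast[OF z] .
  have "\<not> clock (f (Suc k)) \<le> lv l ?w"
  proof
    assume "clock (f (Suc k)) \<le> lv l ?w"
    then have x: "x < lv l ?w" using k(1) by (simp add: at_time_def)
    have wh: "length ?w \<le> h" using z by simp
    have "?w = [] \<or> lnk (f l) ?w \<noteq> butlast ?w"
    proof (rule disjCI)
      assume "\<not> lnk (f l) ?w \<noteq> butlast ?w"
      then have "length z = length z - 1 - 1" using l(2) by (metis length_butlast)
      then show "?w = []" using z by (cases z) auto
    qed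
    then obtain j where j: "j < n" "prefix z (fst (req j))" "lv l ?w - 2 ^ (h - length ?w) \<le> snd (req j)"
      "snd (req j) \<le> clock (f l)" using I.lnk_down[of ?w] wh l(2) by metis
    have "0 < (2::real) ^ (h - length z)" by simp
    then have "x - theta h z < snd (req j)" using j(3) x w2 unfolding theta_def by linarith
    moreover have "snd (req j) \<le> y" using j l(1) by (simp add: at_time_def)
    ultimately show False using no j by blast
  qed
  then have "heading h (f l) ?w (x + theta h z / 2)" using heading_or_visited[OF kl(1) _ k(2)] kl by auto
  then obtain i c s where c: "(i, c, butlast c, s) \<in> msgs (f l)" "strict_prefix ?w c"
    "s + 2 ^ (h - length ?w) - 2 ^ (h - length c) \<le> x + theta h z / 2" unfolding heading_def by blast
  have "c \<noteq> []" "length c \<le> h" using c(2) I.msg_edge[OF c(1)] by auto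
  then have "y < s + 2 ^ (h - length c)" "2 * 2 ^ (h - length c) \<le> (2::real) ^ (h - length ?w)"
    using deadline[OF kl(2) c(1)] l(1) edge_w_up[of c h] two_pow_strict_prefix[OF c(2)]
    by (auto simp: at_time_def)
  then show ?thesis using c(3) by linarith
qed

end

section \<open>Paths of upward links\<close>

lemma (in arrow_state) turning_point:
  assumes "length y < h"
  shows "\<exists>w. prefix w y \<and> (w = [] \<or> lnk C w \<noteq> butlast w) \<and>
    (\<forall>y'. strict_prefix w y' \<and> prefix y' y \<longrightarrow> lnk C y' = butlast y')"
  using assms
proof (induction y rule: rev_induct)
  case Nil
  then show ?case by auto
next
  case (snoc a y)
  show ?case
  proof (cases "lnk C (y @ [a]) = butlast (y @ [a])")
    case True
    from snoc obtain w where "prefix w y" "w = [] \<or> lnk C w \<noteq> butlast w"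
      "\<forall>y'. strict_prefix w y' \<and> prefix y' y \<longrightarrow> lnk C y' = butlast y'" by auto
    then show ?thesis using True by (intro exI[of _ w]) (auto simp: prefix_snoc)
  next
    case False
    then show ?thesis by (intro exI[of _ "y @ [a]"]) (auto simp: prefix_order.less_le_not_le)
  qed
qed

text \<open>Chains \<open>lnk_up\<close> along the path; the edge lengths telescope to the
  difference of powers.\<close>

lemma (in arrow_state) lv_climb:
  assumes "length y \<le> h" "prefix w y"
    and "\<And>y'. strict_prefix w y' \<Longrightarrow> prefix y' y \<Longrightarrow> lnk C y' = butlast y'"
  shows "lv y \<le> lv w + 2 ^ (h - length w) - 2 ^ (h - length y)"
  using assms
proof (induction y rule: rev_induct)
  case (snoc a y)
  show ?case
  proof (cases "w = y @ [a]")
    case False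
    then have w: "prefix w y" "strict_prefix w (y @ [a])" using snoc.prems by (auto simp: prefix_snoc strict_prefix_def)
    then have "lnk C (y @ [a]) = butlast (y @ [a])" using snoc.prems by auto
    from lnk_up[OF snoc.prems(1) _ this] have "lv (y @ [a]) - 2 ^ (h - length (y @ [a])) \<le> lv y" by simp
    moreover have "lv y \<le> lv w + 2 ^ (h - length w) - 2 ^ (h - length y)"
      using snoc.prems w by (intro snoc.IH) (auto simp: prefix_snoc)
    moreover have "2 ^ (h - length y) = 2 * (2::real) ^ (h - length (y @ [a]))"
      using two_pow_butlast[of "y @ [a]" h] snoc.prems(1) by simp
    ultimately show ?thesis by linarith
  qed simp
qed simp

text \<open>Of the delays, the trace keeps the upper bound common to both modes, so one analysis
  serves synchronous and asynchronous executions.\<close>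

lemma ghost_trace_exists:
  assumes "arrow_reach h sync n req C"
  shows "\<exists>f lv L. f 0 = init_cfg req \<and> lv 0 = (\<lambda>_. 0) \<and> f L = C \<and>
    (\<forall>k<L. ghost_step h n req (f k) (lv k) (f (Suc k)) (lv (Suc k)))"
proof -
  have ext: "\<exists>f lv L. f 0 = init_cfg req \<and> lv 0 = (\<lambda>_. 0) \<and> f L = C' \<and>
      (\<forall>k<L. ghost_step h n req (f k) (lv k) (f (Suc k)) (lv (Suc k)))"
    if f: "f 0 = init_cfg req" "lv 0 = (\<lambda>_. 0)" "f L = C" "\<forall>k<L. ghost_step h n req (f k) (lv k) (f (Suc k)) (lv (Suc k))"
      and st: "\<And>lv. \<exists>lv'. ghost_step h n req C lv C' lv'" for f lv L C C'
  proof -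
    obtain l where l: "ghost_step h n req C (lv L) C' l" using st by blast
    define f' where "f' = f(Suc L := C')"
    define lv' where "lv' = lv(Suc L := l)"
    have "ghost_step h n req (f' k) (lv' k) (f' (Suc k)) (lv' (Suc k))" if "k < Suc L" for k
      using that f l by (cases "k = L") (auto simp: f'_def lv'_def)
    then show ?thesis using f by (intro exI[of _ f'] exI[of _ lv'] exI[of _ "Suc L"]) (auto simp: f'_def lv'_def)
  qed
  from assms show ?thesis
  proof induction
    case init
    show ?case by (intro exI[of _ "\<lambda>_. init_cfg req"] exI[of _ "\<lambda>_ _. 0"] exI[of _ 0]) simp
  next
    case (issue C i)
    then show ?case by (elim exE conjE) (rule ext, auto simp: ghost_step_def)
  next
    case (recv C i w u s t)
    have "\<exists>lv'. ghost_step h n req C lv (recv_step C (i, w, u, s) t) lv'" for lv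
      using recv unfolding ghost_step_def by blast
    with recv.IH show ?case by (elim exE conjE) (rule ext)
  qed
qed

section \<open>Busy edges and where they lead\<close>

context execution
begin

lemma match: "k \<le> L \<Longrightarrow> msgs_match n (f k)"
proof (induction k)
  case 0
  then show ?case by (simp add: init init_cfg_def msgs_match_def)
next
  case (Suc k)
  then show ?case using msgs_match_step(1)[OF _ steps[of k]] by simp
qed

lemma pending_cost_eq: "k \<le> L \<Longrightarrow>
  pending_cost req (f k) (clock (f k)) = (\<Sum>j<k. (clock (f (Suc j)) - clock (f j)) * card (msgs (f j)))"
proof (induction k)
  case 0
  then show ?case by (simp add: init init_cfg_def pending_cost_def)
next
  case (Suc k)
  then show ?case using msgs_match_step(2)[OF match[of k] steps[of k]]
      pending_cost_advance[OF match[of k], of req "clock (f (Suc k))" "clock (f k)"] by simp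
qed

lemma arrow_cost_eq:
  assumes "arrow_complete n (f L)"
  shows "arrow_cost n req (f L) = (\<Sum>k<L. (clock (f (Suc k)) - clock (f k)) * card (msgs (f k)))"
proof -
  have "arrow_cost n req (f L) = pending_cost req (f L) (clock (f L))"
    using assms unfolding arrow_cost_def pending_cost_def arrow_complete_def
    by (auto intro!: sum.cong split: option.split)
  then show ?thesis using pending_cost_eq[of L] by simp
qed

definition busy :: "nat \<Rightarrow> nat list \<Rightarrow> bool" where
  "busy k z \<longleftrightarrow> z \<noteq> [] \<and> (\<exists>i s. (i, z, butlast z, s) \<in> msgs (f k) \<or> (i, butlast z, z, s) \<in> msgs (f k))"

text \<open>An edge is named by its lower end, and \<open>msg_unique\<close> allows it only one
  message.\<close>

lemma card_msgs:
  assumes "k \<le> L"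
  shows "finite {z. busy k z}" "card (msgs (f k)) = card {z. busy k z}"
proof -
  interpret arrow_state h n req "f k" "lv k" using state assms .
  define c where "c m = (case m of (i, a, b, s) \<Rightarrow> if a \<noteq> [] \<and> b = butlast a then a else b)"
    for m :: "nat \<times> nat list \<times> nat list \<times> real"
  have c: "c m \<noteq> [] \<and> (fst (snd m) = c m \<and> fst (snd (snd m)) = butlast (c m) \<or>
      fst (snd m) = butlast (c m) \<and> fst (snd (snd m)) = c m)" if "m \<in> msgs (f k)" for m
    using that msg_edge[of "fst m" "fst (snd m)" "fst (snd (snd m))" "snd (snd (snd m))"]
    by (auto simp: c_def nbr_def split: prod.splits)
  have inj: "inj_on c (msgs (f k))"
  proof (rule inj_onI)
    fix m m' assume m: "m \<in> msgs (f k)" "m' \<in> msgs (f k)" "c m = c m'"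
    obtain i a b s i' a' b' s' where eq: "m = (i, a, b, s)" "m' = (i', a', b', s')" by (metis prod_cases4)
    have "a' = a \<and> b' = b \<or> a' = b \<and> b' = a" using c[OF m(1)] c[OF m(2)] m(3) eq by auto
    then show "m = m'" using msg_unique[of i a b s i' a' b' s'] m eq by auto
  qed
  have img: "c ` msgs (f k) = {z. busy k z}"
  proof
    show "c ` msgs (f k) \<subseteq> {z. busy k z}"
    proof
      fix z assume "z \<in> c ` msgs (f k)"
      then obtain m where m: "m \<in> msgs (f k)" "z = c m" by auto
      obtain i a b s where "m = (i, a, b, s)" by (metis prod_cases4)
      then have "(i, a, b, s) \<in> msgs (f k)" "z \<noteq> []" "a = z \<and> b = butlast z \<or> a = butlast z \<and> b = z"
        using c[OF m(1)] m by auto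
      then show "z \<in> {z. busy k z}" unfolding busy_def by blast
    qed
    show "{z. busy k z} \<subseteq> c ` msgs (f k)"
    proof
      fix z assume "z \<in> {z. busy k z}"
      then obtain i s where z: "z \<noteq> []" "(i, z, butlast z, s) \<in> msgs (f k) \<or> (i, butlast z, z, s) \<in> msgs (f k)"
        by (auto simp: busy_def)
      have "\<not> (butlast z \<noteq> [] \<and> z = butlast (butlast z))"
      proof
        assume "butlast z \<noteq> [] \<and> z = butlast (butlast z)"
        then have "length z = length z - 1 - 1" by (metis length_butlast)
        then show False using z(1) by (cases z) auto
      qed
      then have "c (i, z, butlast z, s) = z" "c (i, butlast z, z, s) = z" using z(1) unfolding c_def prod.case by (simp_all only: if_False simp_thms) auto
      then show "z \<in> c ` msgs (f k)" using z(2) by (metis image_eqI)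
    qed
  qed
  have "finite (fst ` msgs (f k))" "inj_on fst (msgs (f k))"
    using match[OF assms] msgs_match_finite[OF match[OF assms]] by (auto simp: msgs_match_def)
  then have "finite (msgs (f k))" by (simp add: finite_image_iff)
  then show "finite {z. busy k z}" "card (msgs (f k)) = card {z. busy k z}"
    using img card_image[OF inj] by (metis finite_imageI, simp)
qed

lemma busy_edge:
  assumes "k \<le> L" "busy k z"
  shows "z \<noteq> []" "length z \<le> h" "lnk (f k) z \<noteq> butlast z" "lnk (f k) (butlast z) \<noteq> z"
proof -
  interpret arrow_state h n req "f k" "lv k" using state assms by simp
  show "z \<noteq> []" "length z \<le> h" "lnk (f k) z \<noteq> butlast z" "lnk (f k) (butlast z) \<noteq> z"
    using assms(2) msg_edge by (auto simp: busy_def)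
qed

text \<open>A climbing message carries a recent request from below \<open>z\<close>. A descending
  one goes to a node that does not link upwards, so an earlier request lies below it.\<close>

lemma busy_cases:
  assumes k: "at_time k x" and z: "busy k z"
  shows "(\<exists>j<n. prefix z (fst (req j)) \<and> x - theta h z < snd (req j) \<and> snd (req j) \<le> x) \<or>
    used_down z x \<and> (\<exists>j<n. prefix z (fst (req j)) \<and> snd (req j) \<le> x)"
proof -
  have kL: "k < L" "clock (f k) \<le> x" "x < clock (f (Suc k))" using k by (auto simp: at_time_def)
  interpret arrow_state h n req "f k" "lv k" using state kL by simp
  note e = busy_edge[OF less_imp_le[OF kL(1)] z]
  from z consider i s where "(i, z, butlast z, s) \<in> msgs (f k)" | i s where "(i, butlast z, z, s) \<in> msgs (f k)"
    by (auto simp: busy_def)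
  then show ?thesis
  proof cases
    case 1
    have u: "i < n" "prefix z (fst (req i))" "snd (req i) \<le> s" "s \<le> snd (req i) + 2 ^ (h - length z) - 1"
      using msg_up[OF 1 e(1)] by auto
    have "x < s + 2 ^ (h - length z)" using deadline[OF kL(1) 1] kL edge_w_up[OF e(1), of h] by simp
    moreover have "0 < (2::real) ^ (h - length z)" by simp
    ultimately have "x - theta h z < snd (req i)" using u unfolding theta_def by linarith
    moreover have "snd (req i) \<le> x" using u msg_time[OF 1] kL by simp
    ultimately show ?thesis using u by blast
  next
    case 2
    then have "used_down z x" using k e by (auto simp: used_down_def)
    moreover obtain j where "j < n" "prefix (lnk (f k) z) (fst (req j))" "snd (req j) \<le> clock (f k)"
      using lnk_down[OF e(2)] e(3) by blast
    moreover have "prefix z (lnk (f k) z)" using prefix_lnk_down e by blast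
    ultimately show ?thesis using kL by (meson order_trans prefix_order.trans)
  qed
qed

text \<open>Following the links from the parent of a busy edge leads up to a turning point \<open>w\<close> and from
  there down to another child \<open>s\<close> of \<open>w\<close>, which holds a request.\<close>

lemma busy_turn:
  assumes k: "at_time k x" and z: "busy k z"
  obtains w s where "strict_prefix w z" "s \<noteq> []" "butlast s = w" "\<not> prefix s z"
    "\<And>y. busy k y \<Longrightarrow> strict_prefix y z \<Longrightarrow> prefix y w"
    "(\<exists>j<n. prefix s (fst (req j)) \<and> x - theta h s < snd (req j) \<and> snd (req j) \<le> x) \<or>
      used_up s x \<and> (\<exists>j<n. prefix s (fst (req j)) \<and> snd (req j) \<le> x)"
proof -
  have kL: "k < L" "clock (f k) \<le> x" "x < clock (f (Suc k))" using k by (auto simp: at_time_def)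
  interpret arrow_state h n req "f k" "lv k" using state kL by simp
  note e = busy_edge[OF less_imp_le[OF kL(1)] z]
  have lb: "length (butlast z) < h" using e(1,2) by (cases z) auto
  obtain w where w: "prefix w (butlast z)" "w = [] \<or> lnk (f k) w \<noteq> butlast w"
    and path: "\<And>y. strict_prefix w y \<Longrightarrow> prefix y (butlast z) \<Longrightarrow> lnk (f k) y = butlast y"
    using turning_point[OF lb] by blast
  have wz: "strict_prefix w z" using w(1) strict_prefix_butlast[OF e(1)] by (rule prefix_order.le_less_trans)
  have wh: "length w < h" using prefix_length_le[OF w(1)] lb by simp
  define s where "s = lnk (f k) w"
  have "nbr w s" "length s \<le> h" using lnk_internal[OF wh] by (auto simp: s_def)
  then have s: "s \<noteq> []" "butlast s = w" "length s \<le> h" using w(2) by (auto simp: nbr_def s_def)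
  have sw: "strict_prefix w s" using strict_prefix_butlast[OF s(1)] s(2) by simp
  \<comment> \<open>If \<open>s\<close> were \<open>z\<close>, a link would point across a busy
    edge; if it were strictly above \<open>z\<close>, it would lie on the upward path and link back
    to \<open>w\<close>.\<close>
  have nsz: "\<not> prefix s z"
  proof
    assume "prefix s z"
    then consider "s = z" | "strict_prefix s z" by (auto simp: strict_prefix_def)
    then show False
    proof cases
      case 1 then show False using e(4) s(2) by (auto simp: s_def)
    next
      case 2
      then have "lnk (f k) s = w" using path[OF sw] prefix_butlastI s(2) by auto
      moreover have "w \<noteq> s" using sw by (simp add: strict_prefix_def)
      ultimately show False using lnk_asym[of w s] wh s_def by (metis less_imp_le_nat)
    qed
  qed
  \<comment> \<open>Nodes strictly between \<open>w\<close> and \<open>z\<close> link upwards, so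
    the edges above them are not busy.\<close>
  have sep: "prefix y w" if "busy k y" "strict_prefix y z" for y
  proof (rule ccontr)
    assume "\<not> prefix y w"
    then have "strict_prefix w y" using that(2) wz
      by (metis prefix_same_cases strict_prefix_def)
    then have "lnk (f k) y = butlast y" using path prefix_butlastI[OF that(2)] by blast
    then show False using busy_edge(3)[OF _ that(1)] kL by simp
  qed
  obtain j where j: "j < n" "prefix s (fst (req j))" "lv k w - 2 ^ (h - length w) \<le> snd (req j)" "snd (req j) \<le> clock (f k)"
    using lnk_down[of w] w(2) wh unfolding s_def by (meson less_imp_le_nat)
  have pw: "2 ^ (h - length w) = 2 * (2::real) ^ (h - length s)" using two_pow_butlast[OF s(1,3)] s(2) by simp
  from z consider i r where "(i, z, butlast z, r) \<in> msgs (f k)" | i r where "(i, butlast z, z, r) \<in> msgs (f k)"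
    by (auto simp: busy_def)
  then have "(\<exists>j<n. prefix s (fst (req j)) \<and> x - theta h s < snd (req j) \<and> snd (req j) \<le> x) \<or>
      used_up s x \<and> (\<exists>j<n. prefix s (fst (req j)) \<and> snd (req j) \<le> x)"
  proof cases
    case 1
    have "r + 2 ^ (h - length w) - 2 ^ (h - length z) \<le> x + theta h s / 2"
    proof -
      have "0 < (2::real) ^ (h - length z)" by simp
      moreover have "r \<le> x" using msg_time[OF 1] kL by simp
      ultimately show ?thesis using pw unfolding theta_def by linarith
    qed
    then have "heading h (f k) w (x + theta h s / 2)"
      unfolding heading_def using 1 wz path prefix_butlastI by blast
    then have "used_up s x" unfolding used_up_def using s k by (auto simp: s_def)
    then show ?thesis using j kL by (meson order_trans)
  next
    case 2
    have "r \<le> lv k (butlast z)" using msg_down[OF 2 e(1)] by simp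
    moreover have "lv k (butlast z) \<le> lv k w + 2 ^ (h - length w) - 2 ^ (h - length (butlast z))"
      by (rule lv_climb) (use lb w(1) path in auto)
    moreover have "x < r + 2 ^ (h - length z)" using deadline[OF kL(1) 2] kL edge_w_down[OF e(1), of h] by simp
    moreover have "0 < (2::real) ^ (h - length z)" by simp
    \<comment> \<open>The visit to \<open>w\<close> was less than \<open>2 ^ (h - length w)\<close>
      before \<open>x\<close>, and the request at most that long before the visit. Twice this length
      is \<open>theta h s\<close>, which is why \<open>theta\<close> has the factor 4.\<close>
    ultimately have "x - theta h s < snd (req j)"
      using j(3) pw two_pow_butlast[OF e(1,2)] unfolding theta_def by linarith
    then show ?thesis using j kL by (meson order_trans)
  qed
  then show ?thesis using that wz s nsz sep by blast
qed

end

section \<open>Charging Arrow to the tour\<close>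

locale arrow_vs_tour = E: execution h n req f lv L + T: tour h n v t
  for h n req f lv L v t +
  assumes visited: "j < n \<Longrightarrow> \<exists>i<n. v i = fst (req j) \<and> t i = snd (req j)"
begin

text \<open>The last conjunct provides a past request below \<open>z\<close>, whose active period
  can pay for the idle time.\<close>

definition idle :: "(nat list \<Rightarrow> real \<Rightarrow> bool) \<Rightarrow> nat list \<Rightarrow> real \<Rightarrow> bool" where
  "idle P z x \<longleftrightarrow> P z x \<and> \<not> T.through z x \<and> \<not> T.active z x \<and> (\<exists>j<n. prefix z (v j) \<and> t j \<le> x)"

lemma charged_or_idle:
  assumes "(\<exists>j<n. prefix z (fst (req j)) \<and> x - theta h z < snd (req j) \<and> snd (req j) \<le> x) \<or>
      P z x \<and> (\<exists>j<n. prefix z (fst (req j)) \<and> snd (req j) \<le> x)"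
    and "\<not> T.through z x"
  shows "z \<in> T.nodes \<and> (T.charged z x \<or> idle P z x)"
proof -
  have tr: "\<exists>i<n. prefix z (v i) \<and> Q (t i)" if "\<exists>j<n. prefix z (fst (req j)) \<and> Q (snd (req j))" for Q
    using that visited by metis
  have "T.active z x \<or> P z x \<and> (\<exists>j<n. prefix z (v j) \<and> t j \<le> x)"
    using assms(1) tr[of "\<lambda>y. x - theta h z < y \<and> y \<le> x"] tr[of "\<lambda>y. y \<le> x"]
    unfolding T.active_def by blast
  then show ?thesis using assms(2) unfolding T.charged_def idle_def T.nodes_def T.active_def by blast
qed

text \<open>Uncrossed busy edges charge themselves, crossed ones the child beyond their turning
  point. The surplus of \<open>card_through_le\<close> becomes \<open>4 * card (T.down x)\<close> by
  \<open>card_crossing\<close>.\<close>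

lemma card_msgs_le:
  assumes k: "E.at_time k x"
  shows "card (msgs (f k)) \<le> 4 * card (T.down x) + 2 * card {z\<in>T.nodes. T.charged z x}
    + card {z\<in>T.nodes. idle E.used_down z x} + card {z\<in>T.nodes. idle E.used_up z x}"
proof -
  have kL: "k \<le> L" using k by (simp add: E.at_time_def)
  let ?B = "{z. E.busy k z}"
  let ?N = "{z\<in>?B. \<not> T.through z x}" and ?Y = "{z\<in>?B. T.through z x}"
  let ?ch = "{z\<in>T.nodes. T.charged z x}"
  have fin: "finite ?B" "finite ?N" "finite ?Y" using E.card_msgs(1)[OF kL] by auto
  let ?R = "\<lambda>z w s. strict_prefix w z \<and> s \<noteq> [] \<and> butlast s = w \<and> \<not> prefix s z \<and>
    (\<forall>y. E.busy k y \<longrightarrow> strict_prefix y z \<longrightarrow> prefix y w) \<and>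
    ((\<exists>j<n. prefix s (fst (req j)) \<and> x - theta h s < snd (req j) \<and> snd (req j) \<le> x) \<or>
      E.used_up s x \<and> (\<exists>j<n. prefix s (fst (req j)) \<and> snd (req j) \<le> x))"
  have "\<forall>z\<in>?B. \<exists>s. ?R z (butlast s) s"
  proof
    fix z assume "z \<in> ?B"
    then have "E.busy k z" by simp
    from E.busy_turn[OF k this] show "\<exists>s. ?R z (butlast s) s" by (smt (verit))
  qed
  then obtain s where s: "\<forall>z\<in>?B. ?R z (butlast (s z)) (s z)" by (rule bchoice[THEN exE])
  have "card ?Y \<le> 2 * (card (T.crossing x) - 1) + card {z\<in>s ` ?Y. \<not> T.through z x}"
  proof (rule T.card_through_le[where w = "\<lambda>z. butlast (s z)"])
    show "prefix y (butlast (s z))" if "y \<in> ?Y" "z \<in> ?Y" "strict_prefix y z" for y z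
      using s that by blast
  qed (use s fin in auto)
  moreover have "{z\<in>s ` ?Y. \<not> T.through z x} \<subseteq> ?ch \<union> {z\<in>T.nodes. idle E.used_up z x}"
  proof
    fix y assume "y \<in> {z\<in>s ` ?Y. \<not> T.through z x}"
    then obtain z where "z \<in> ?B" "y = s z" "\<not> T.through y x" by auto
    then show "y \<in> ?ch \<union> {z\<in>T.nodes. idle E.used_up z x}"
      using charged_or_idle[of y x E.used_up] s by blast
  qed
  then have "card {z\<in>s ` ?Y. \<not> T.through z x} \<le> card (?ch \<union> {z\<in>T.nodes. idle E.used_up z x})"
    by (intro card_mono) (use T.finite_nodes in auto)
  moreover have "card (?ch \<union> {z\<in>T.nodes. idle E.used_up z x}) \<le> card ?ch + card {z\<in>T.nodes. idle E.used_up z x}"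
    by (rule card_Un_le)
  moreover have "?N \<subseteq> ?ch \<union> {z\<in>T.nodes. idle E.used_down z x}"
    using charged_or_idle[of _ x E.used_down] E.busy_cases[OF k] by blast
  then have "card ?N \<le> card (?ch \<union> {z\<in>T.nodes. idle E.used_down z x})"
    by (intro card_mono) (use T.finite_nodes in auto)
  moreover have "card (?ch \<union> {z\<in>T.nodes. idle E.used_down z x}) \<le> card ?ch + card {z\<in>T.nodes. idle E.used_down z x}"
    by (rule card_Un_le)
  moreover have "card ?B \<le> card ?N + card ?Y"
  proof -
    have "?B = ?N \<union> ?Y" by auto
    then have "card ?B = card (?N \<union> ?Y)" by (rule arg_cong)
    then show ?thesis using card_Un_le[of ?N ?Y] by linarith
  qed
  moreover note T.card_crossing[of x] E.card_msgs(2)[OF kL]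
  ultimately show ?thesis by linarith
qed

text \<open>The covers from \<open>idle_bound\<close> are chosen for all nodes at once, so that
  measurable sets can replace the idle times under the integral.\<close>

lemma idle_sets:
  assumes gap: "\<And>z x y. P z x \<Longrightarrow> P z y \<Longrightarrow> x \<le> y \<Longrightarrow>
    (\<And>j. j < n \<Longrightarrow> prefix z (fst (req j)) \<Longrightarrow> x - theta h z < snd (req j) \<Longrightarrow> snd (req j) \<le> y \<Longrightarrow> False) \<Longrightarrow>
    y \<le> x + theta h z / 2"
  shows "\<exists>S. \<forall>z. S z \<in> sets borel \<and> (\<forall>x. idle P z x \<longrightarrow> x \<in> S z) \<and>
    emeasure lborel (S z) \<le> emeasure lborel {x. T.charged z x}"
proof (rule choice, rule allI)
  fix z
  have "\<exists>S\<in>sets borel. (\<forall>x. P z x \<and> \<not> T.through z x \<and> \<not> T.active z x \<and> (\<exists>j<n. prefix z (v j) \<and> t j \<le> x) \<longrightarrow> x \<in> S) \<and>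
     emeasure lborel S \<le> emeasure lborel {x. T.charged z x}"
  proof (rule T.idle_bound)
    fix x y assume xy: "P z x" "P z y" "x \<le> y"
      and no: "\<And>j. j < n \<Longrightarrow> prefix z (v j) \<Longrightarrow> x - theta h z < t j \<Longrightarrow> t j \<le> y \<Longrightarrow> False"
    show "y \<le> x + theta h z / 2"
    proof (rule gap[OF xy])
      fix j assume "j < n" "prefix z (fst (req j))" "x - theta h z < snd (req j)" "snd (req j) \<le> y"
      then show False using visited[of j] no by metis
    qed
  qed
  then show "\<exists>S. S \<in> sets borel \<and> (\<forall>x. idle P z x \<longrightarrow> x \<in> S) \<and>
    emeasure lborel S \<le> emeasure lborel {x. T.charged z x}" unfolding idle_def by blast
qed

lemma arrow_cost_le:
  assumes "arrow_complete n (f L)"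
  shows "arrow_cost n req (f L) \<le> 44 * T.tour_cost"
proof -
  obtain S1 where S1: "\<And>z. S1 z \<in> sets borel" "\<And>z x. idle E.used_down z x \<Longrightarrow> x \<in> S1 z"
    "\<And>z. emeasure lborel (S1 z) \<le> emeasure lborel {x. T.charged z x}"
    using idle_sets[of E.used_down, OF E.used_down_gap] by blast
  obtain S2 where S2: "\<And>z. S2 z \<in> sets borel" "\<And>z x. idle E.used_up z x \<Longrightarrow> x \<in> S2 z"
    "\<And>z. emeasure lborel (S2 z) \<le> emeasure lborel {x. T.charged z x}"
    using idle_sets[of E.used_up, OF E.used_up_gap] by blast
  let ?c = "\<lambda>k. clock (f k)"
  let ?I = "\<lambda>k. {?c k..<?c (Suc k)}"
  define F where "F P x = ennreal (real (card {z\<in>T.nodes. P z x}))" for P :: "nat list \<Rightarrow> real \<Rightarrow> bool" and x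
  define G where "G x = ennreal (real (card (T.down x)))" for x
  let ?\<Phi> = "\<lambda>x. 4 * G x + (2 * F T.charged x + (F (\<lambda>z x. x \<in> S1 z) x + F (\<lambda>z x. x \<in> S2 z) x))"
  have Fint: "(\<integral>\<^sup>+ x. F P x \<partial>lborel) = (\<Sum>z\<in>T.nodes. emeasure lborel {x. P z x})"
    and Fmeas [measurable]: "F P \<in> borel_measurable lborel"
    if "\<And>z. {x. P z x} \<in> sets borel" for P
  proof -
    show "(\<integral>\<^sup>+ x. F P x \<partial>lborel) = (\<Sum>z\<in>T.nodes. emeasure lborel {x. P z x})"
      unfolding F_def using that by (intro nn_integral_card T.finite_nodes)
    show "F P \<in> borel_measurable lborel"
      unfolding F_def card_eq_sum_indicator[OF T.finite_nodes] using that by simp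
  qed
  have Gmeas: "G \<in> borel_measurable lborel"
  proof -
    have "{x. t i \<le> x \<and> x < t (i - 1)} = {t i..<t (i - 1)}" for i by auto
    then show ?thesis unfolding G_def T.down_def card_eq_sum_indicator[OF finite_atLeastLessThan] by auto
  qed
  \<comment> \<open>At most one configuration is current at time \<open>x\<close>, so the sum is its
    number of messages, or 0.\<close>
  have point: "(\<Sum>k<L. ennreal (real (card (msgs (f k)))) * indicator (?I k) x) \<le> ?\<Phi> x" for x
  proof (cases "\<exists>k<L. x \<in> ?I k")
    case False
    then have "(\<Sum>k<L. ennreal (real (card (msgs (f k)))) * indicator (?I k) x) = 0"
      by (intro sum.neutral) (auto simp: indicator_def)
    then show ?thesis by simp
  next
    case True
    then obtain k where k: "k < L" "x \<in> ?I k" by blast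
    then have at: "E.at_time k x" by (simp add: E.at_time_def)
    have only: "l = k" if "l < L" "x \<in> ?I l" for l
    proof -
      have "E.at_time l x" using that by (simp add: E.at_time_def)
      then show ?thesis using E.at_time_le[OF at, of l x] E.at_time_le[of l x k x] at by simp
    qed
    have "(\<Sum>k<L. ennreal (real (card (msgs (f k)))) * indicator (?I k) x)
       = (\<Sum>l\<in>{k}. ennreal (real (card (msgs (f l)))) * indicator (?I l) x)"
    proof (rule sum.mono_neutral_right)
      show "\<forall>l\<in>{..<L} - {k}. ennreal (real (card (msgs (f l)))) * indicator (?I l) x = 0"
      proof
        fix l assume "l \<in> {..<L} - {k}"
        then have "x \<notin> ?I l" using only by blast
        then show "ennreal (real (card (msgs (f l)))) * indicator (?I l) x = 0" by simp
      qed
    qed (use k in auto)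
    also have "\<dots> = ennreal (real (card (msgs (f k))))" using k by simp
    also have "\<dots> \<le> ennreal (4 * real (card (T.down x)) + (2 * real (card {z\<in>T.nodes. T.charged z x})
       + (real (card {z\<in>T.nodes. x \<in> S1 z}) + real (card {z\<in>T.nodes. x \<in> S2 z}))))"
    proof (rule ennreal_leI)
      have "card {z\<in>T.nodes. idle E.used_down z x} \<le> card {z\<in>T.nodes. x \<in> S1 z}"
        "card {z\<in>T.nodes. idle E.used_up z x} \<le> card {z\<in>T.nodes. x \<in> S2 z}"
        using S1(2) S2(2) T.finite_nodes by (auto intro!: card_mono)
      then show "real (card (msgs (f k))) \<le> 4 * real (card (T.down x)) + (2 * real (card {z\<in>T.nodes. T.charged z x})
       + (real (card {z\<in>T.nodes. x \<in> S1 z}) + real (card {z\<in>T.nodes. x \<in> S2 z})))"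
        using card_msgs_le[OF at] by linarith
    qed
    also have "\<dots> = ?\<Phi> x" unfolding F_def G_def by (simp add: ennreal_mult)
    finally show ?thesis .
  qed
  have cm: "?c k \<le> ?c (Suc k)" if "k < L" for k using E.clock_mono[of k "Suc k"] that by simp
  have "ennreal (arrow_cost n req (f L)) = (\<Sum>k<L. ennreal ((?c (Suc k) - ?c k) * card (msgs (f k))))"
    unfolding E.arrow_cost_eq[OF assms] using cm by (intro sum_ennreal[symmetric]) simp
  also have "\<dots> = (\<Sum>k<L. \<integral>\<^sup>+ x. ennreal (real (card (msgs (f k)))) * indicator (?I k) x \<partial>lborel)"
    using cm by (intro sum.cong) (auto simp: nn_integral_cmult_indicator ennreal_mult mult.commute)
  also have "\<dots> = (\<integral>\<^sup>+ x. (\<Sum>k<L. ennreal (real (card (msgs (f k)))) * indicator (?I k) x) \<partial>lborel)"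
    by (rule nn_integral_sum[symmetric]) auto
  also have "\<dots> \<le> (\<integral>\<^sup>+ x. ?\<Phi> x \<partial>lborel)" by (intro nn_integral_mono point)
  also have "\<dots> = 4 * (\<integral>\<^sup>+ x. G x \<partial>lborel) + (2 * (\<integral>\<^sup>+ x. F T.charged x \<partial>lborel) +
      ((\<integral>\<^sup>+ x. F (\<lambda>z x. x \<in> S1 z) x \<partial>lborel) + (\<integral>\<^sup>+ x. F (\<lambda>z x. x \<in> S2 z) x \<partial>lborel)))"
    using Gmeas Fmeas[of T.charged] Fmeas[of "\<lambda>z x. x \<in> S1 z"] Fmeas[of "\<lambda>z x. x \<in> S2 z"] T.sets_charged S1(1) S2(1)
    by (simp add: nn_integral_add nn_integral_cmult)
  \<comment> \<open>The constant is 4 for backward steps, 20 for nodes charged twice, and 10 for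
    each kind of idle time.\<close>
  also have "\<dots> \<le> 4 * ennreal T.tour_cost + (2 * ennreal (10 * T.tour_cost) + (ennreal (10 * T.tour_cost) + ennreal (10 * T.tour_cost)))"
  proof (intro add_mono mult_left_mono)
    show "(\<integral>\<^sup>+ x. G x \<partial>lborel) \<le> ennreal T.tour_cost" unfolding G_def by (rule T.nn_integral_down)
    show "(\<integral>\<^sup>+ x. F T.charged x \<partial>lborel) \<le> ennreal (10 * T.tour_cost)"
      using T.sum_emeasure_charged by (simp add: Fint T.sets_charged)
    show "(\<integral>\<^sup>+ x. F (\<lambda>z x. x \<in> S1 z) x \<partial>lborel) \<le> ennreal (10 * T.tour_cost)"
      using sum_mono[of T.nodes, OF S1(3)] T.sum_emeasure_charged S1(1) by (simp add: Fint) (meson order_trans)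
    show "(\<integral>\<^sup>+ x. F (\<lambda>z x. x \<in> S2 z) x \<partial>lborel) \<le> ennreal (10 * T.tour_cost)"
      using sum_mono[of T.nodes, OF S2(3)] T.sum_emeasure_charged S2(1) by (simp add: Fint) (meson order_trans)
  qed simp_all
  also have "\<dots> = ennreal (44 * T.tour_cost)"
  proof -
    have "4 * ennreal T.tour_cost = ennreal (4 * T.tour_cost)" "2 * ennreal (10 * T.tour_cost) = ennreal (20 * T.tour_cost)"
      using T.tour_cost_nonneg ennreal_mult[of 4 T.tour_cost] ennreal_mult[of 2 "10 * T.tour_cost"] by simp_all
    then show ?thesis using T.tour_cost_nonneg by (simp flip: ennreal_plus)
  qed
  finally show ?thesis using T.tour_cost_nonneg by (simp add: ennreal_le_iff)
qed

end

section \<open>The competitive ratio\<close>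

lemma opt_cost_attained:
  assumes "1 \<le> n"
  obtains \<pi> where "\<pi> permutes {0..<n}" "\<pi> 0 = 0"
    "opt_cost h n req = (\<Sum>i\<in>{1..<n}. max (dT h (fst (req (\<pi> (i - 1)))) (fst (req (\<pi> i))))
                                           (snd (req (\<pi> (i - 1))) - snd (req (\<pi> i))))"
proof -
  let ?g = "\<lambda>\<pi>. (\<Sum>i\<in>{1..<n}. max (dT h (fst (req (\<pi> (i - 1)))) (fst (req (\<pi> i))))
                                           (snd (req (\<pi> (i - 1))) - snd (req (\<pi> i))))"
  let ?A = "{?g \<pi> | \<pi>. \<pi> permutes {0..<n} \<and> \<pi> 0 = 0}"
  have "?A \<subseteq> ?g ` {\<pi>. \<pi> permutes {0..<n}}" by blast
  then have "finite ?A" by (rule finite_subset) (simp add: finite_permutations)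
  moreover have "id permutes {0..<n} \<and> id 0 = 0" by (simp add: permutes_id)
  then have "?A \<noteq> {}" by blast
  ultimately have "Min ?A \<in> ?A" by (rule Min_in)
  then show ?thesis using that unfolding opt_cost_def by blast
qed

lemma competitive:
  assumes n: "1 \<le> n" and leaf: "\<forall>i<n. length (fst (req i)) = h \<and> 0 \<le> snd (req i)"
    and t0: "snd (req 0) = 0"
    and reach: "arrow_reach h sync n req C" and complete: "arrow_complete n C"
  shows "arrow_cost n req C \<le> 44 * opt_cost h n req"
proof -
  obtain f lv L where tr: "f 0 = init_cfg req" "lv 0 = (\<lambda>_. 0)" "f L = C"
    "\<And>k. k < L \<Longrightarrow> ghost_step h n req (f k) (lv k) (f (Suc k)) (lv (Suc k))"
    using ghost_trace_exists[OF reach] by blast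
  obtain \<pi> where \<pi>: "\<pi> permutes {0..<n}" "\<pi> 0 = 0"
    and opt: "opt_cost h n req = (\<Sum>i\<in>{1..<n}. max (dT h (fst (req (\<pi> (i - 1)))) (fst (req (\<pi> i))))
                                           (snd (req (\<pi> (i - 1))) - snd (req (\<pi> i))))"
    using opt_cost_attained[OF n] by blast
  have lt: "\<pi> i < n" if "i < n" for i using permutes_in_image[OF \<pi>(1), of i] that by simp
  have surj: "\<exists>i<n. \<pi> i = j" if "j < n" for j
    using permutes_image[OF \<pi>(1)] that by (metis (no_types, lifting) atLeastLessThan_iff image_iff zero_le)
  \<comment> \<open>The tour follows an optimal ordering; surjectivity of the permutation means that
    it visits every request.\<close>
  interpret arrow_vs_tour h n req f lv L "\<lambda>i. fst (req (\<pi> i))" "\<lambda>i. snd (req (\<pi> i))"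
  proof unfold_locales
    show "msgs (f L) = {}" using complete tr(3) by (simp add: arrow_complete_def)
    show "\<exists>i<n. fst (req (\<pi> i)) = fst (req j) \<and> snd (req (\<pi> i)) = snd (req j)" if "j < n" for j
      using surj[OF that] by auto
  qed (use n leaf t0 tr \<pi>(2) lt in auto)
  show ?thesis using arrow_cost_le complete tr(3) unfolding T.tour_cost_def opt by simp
qed

theorem theorem1:
  "\<exists>c::real. c > 0 \<and>
     (\<forall>(N :: nat list set) (h :: nat) (n :: nat) (req :: nat \<Rightarrow> nat list \<times> real) (sync :: bool) (C :: cfg).
        is_hst N h \<and> 1 \<le> n \<and> inj_on req {0..<n}
        \<and> (\<forall>i<n. fst (req i) \<in> N \<and> length (fst (req i)) = h \<and> 0 \<le> snd (req i))
        \<and> snd (req 0) = 0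
        \<and> arrow_reach h sync n req C \<and> arrow_complete n C
        \<longrightarrow> arrow_cost n req C \<le> c * opt_cost h n req)"
proof (intro exI[of _ 44] conjI allI impI)
  fix N h n req sync C
  assume "is_hst N h \<and> 1 \<le> n \<and> inj_on req {0..<n}
        \<and> (\<forall>i<n. fst (req i) \<in> N \<and> length (fst (req i)) = h \<and> 0 \<le> snd (req i))
        \<and> snd (req 0) = 0
        \<and> arrow_reach h sync n req C \<and> arrow_complete n C"
  then show "arrow_cost n req C \<le> 44 * opt_cost h n req" by (intro competitive) auto
qed simp

end
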